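(* The following problem is undecidable: given a sentence $\varphi$ of the $\mu$-fragment of the $\mu$-calculus on data words (over some finite alphabet $\Sigma$), decide whether there exists a (finite) data word $w$ with $w\models\varphi$.
   Context: Fix a finite alphabet $\Sigma$ and an infinite set $\mathcal D$ of data values. A data word is a finite sequence $w=(a_1,d_1)\cdots(a_n,d_n)\in(\Sigma\times\mathcal D)^*$; its positions are $1,\dots,n$. Positions $i,j$ are in the same class, $i\sim j$, if $d_i=d_j$. The successor of $i$ is $i+1$ and the predecessor is $i-1$ (when these are positions). The class successor of $i$ is the least position $j>i$ with $j\sim i$ (if any); the class predecessor of $i$ is the greatest position $j<i$ with $j\sim i$ (if any). The $\mu$-calculus on data words: formulas are built from fixpoint variables $x,y,\dots$ by $\varphi::= x\mid A\mid\neg A\mid \mathsf M\varphi\mid\varphi\vee\varphi\mid\varphi\wedge\varphi\mid\mu x.\varphi\mid\nu x.\varphi$, where the atoms $A$ are the letters $a\in\Sigma$ and the zeroary symbols $\mathsf S,\mathsf P,\mathsf{first}^g,\mathsf{last}^g,\mathsf{first}^c,\mathsf{last}^c$, and $\mathsf M\in\{\mathtt X^g,\mathtt X^c,\mathtt Y^g,\mathtt Y^c\}$ (negation is applied to atoms only). Given $w$ and a valuation of the free variables by sets of positions, each formula denotes a set of positions: a letter $a$ holds at $i$ iff $a_i=a$; $\mathsf{first}^g$ holds only at position 1; $\mathsf{last}^g$ only at the last position; $\mathsf{first}^c$ at $i$ iff $i$ has no class predecessor; $\mathsf{last}^c$ at $i$ iff $i$ has no class successor; $\mathsf S$ at $i$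 iff $i$ is not last and $i+1$ is the class successor of $i$; $\mathsf P$ at $i$ iff $i\neq 1$ and $i-1$ is the class predecessor of $i$; $\neg A$ is the complement; $\mathtt X^g\varphi$ ($\mathtt X^c\varphi$, $\mathtt Y^g\varphi$, $\mathtt Y^c\varphi$) holds at $i$ iff the successor (class successor, predecessor, class predecessor) of $i$ exists and $\varphi$ holds there; $\vee,\wedge$ are union and intersection; $\mu x.\varphi$ and $\nu x.\varphi$ denote the least and greatest fixpoints of the monotone map $S\mapsto$ (set denoted by $\varphi$ with $x$ valued $S$). A sentence has no free variables; $w\models\varphi$ means that $\varphi$ holds at position 1 of $w$. The $\mu$-fragment consists of the formulas in which $\nu$ does not occur. *)

theory Defs
  imports Main "HOL-Library.Nat_Bijection"
begin

section \<open>Data words\<close>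

type_synonym ('a, 'd) data_word = "('a \<times> 'd) list"

text \<open>Positions are numbered from 1, list indices from 0.\<close>

definition positions :: "('a, 'd) data_word \<Rightarrow> nat set" where
  "positions w = {1..length w}"

definition letter_at :: "('a, 'd) data_word \<Rightarrow> nat \<Rightarrow> 'a" where
  "letter_at w i = fst (w ! (i - 1))"

definition datum_at :: "('a, 'd) data_word \<Rightarrow> nat \<Rightarrow> 'd" where
  "datum_at w i = snd (w ! (i - 1))"

definition same_class :: "('a, 'd) data_word \<Rightarrow> nat \<Rightarrow> nat \<Rightarrow> bool" where
  "same_class w i j \<longleftrightarrow> datum_at w i = datum_at w j"

definition is_class_succ :: "('a, 'd) data_word \<Rightarrow> nat \<Rightarrow> nat \<Rightarrow> bool" where
  "is_class_succ w i j \<longleftrightarrow> i \<in> positions w \<and> j \<in> positions w \<and> i < j \<and> same_class w i j \<and>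
     (\<forall>k. i < k \<and> k < j \<longrightarrow> \<not> same_class w i k)"

definition is_class_pred :: "('a, 'd) data_word \<Rightarrow> nat \<Rightarrow> nat \<Rightarrow> bool" where
  "is_class_pred w i j \<longleftrightarrow> i \<in> positions w \<and> j \<in> positions w \<and> j < i \<and> same_class w i j \<and>
     (\<forall>k. j < k \<and> k < i \<longrightarrow> \<not> same_class w i k)"


section \<open>The \<open>\<mu>\<close>-calculus on data words\<close>

text \<open>\<open>SuccSame\<close> and \<open>PredSame\<close> are the zeroary symbols \<open>S\<close> and \<open>P\<close>.\<close>

datatype 'a atom =
    Letter 'a | SuccSame | PredSame | FirstG | LastG | FirstC | LastC

datatype modality = XG | XC | YG | YC

datatype 'a fml =
    Var nat
  | Atom "'a atom"
  | NegAtom "'a atom"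
  | Modal modality "'a fml"
  | Or "'a fml" "'a fml"
  | And "'a fml" "'a fml"
  | Mu nat "'a fml"
  | Nu nat "'a fml"

fun holds_atom :: "('a, 'd) data_word \<Rightarrow> 'a atom \<Rightarrow> nat \<Rightarrow> bool" where
  "holds_atom w (Letter a) i \<longleftrightarrow> letter_at w i = a"
| "holds_atom w SuccSame i \<longleftrightarrow> i \<noteq> length w \<and> is_class_succ w i (i + 1)"
| "holds_atom w PredSame i \<longleftrightarrow> i \<noteq> 1 \<and> is_class_pred w i (i - 1)"
| "holds_atom w FirstG i \<longleftrightarrow> i = 1"
| "holds_atom w LastG i \<longleftrightarrow> i = length w"
| "holds_atom w FirstC i \<longleftrightarrow> (\<nexists>j. is_class_pred w i j)"
| "holds_atom w LastC i \<longleftrightarrow> (\<nexists>j. is_class_succ w i j)"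

text \<open>\<open>moves w M i j\<close>: the position reached from \<open>i\<close> by \<open>M\<close> exists and is \<open>j\<close>.\<close>

fun moves :: "('a, 'd) data_word \<Rightarrow> modality \<Rightarrow> nat \<Rightarrow> nat \<Rightarrow> bool" where
  "moves w XG i j \<longleftrightarrow> i \<in> positions w \<and> j \<in> positions w \<and> j = i + 1"
| "moves w YG i j \<longleftrightarrow> i \<in> positions w \<and> j \<in> positions w \<and> i = j + 1"
| "moves w XC i j \<longleftrightarrow> is_class_succ w i j"
| "moves w YC i j \<longleftrightarrow> is_class_pred w i j"

text \<open>
  Valuations are meant to assign sets of positions.  Intersecting with \<^term>\<open>positions w\<close> in the
  variable case makes every formula denote a set of positions under any valuation, so that
  \<^const>\<open>lfp\<close> and \<^const>\<open>gfp\<close>, taken in the lattice of all sets of naturals, are the least and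
  greatest fixpoints in the lattice of sets of positions.
\<close>

fun sem :: "('a, 'd) data_word \<Rightarrow> (nat \<Rightarrow> nat set) \<Rightarrow> 'a fml \<Rightarrow> nat set" where
  "sem w v (Var x) = v x \<inter> positions w"
| "sem w v (Atom A) = {i \<in> positions w. holds_atom w A i}"
| "sem w v (NegAtom A) = positions w - {i \<in> positions w. holds_atom w A i}"
| "sem w v (Modal M \<phi>) = {i \<in> positions w. \<exists>j. moves w M i j \<and> j \<in> sem w v \<phi>}"
| "sem w v (Or \<phi> \<psi>) = sem w v \<phi> \<union> sem w v \<psi>"
| "sem w v (And \<phi> \<psi>) = sem w v \<phi> \<inter> sem w v \<psi>"
| "sem w v (Mu x \<phi>) = lfp (\<lambda>S. sem w (v(x := S)) \<phi>)"
| "sem w v (Nu x \<phi>) = gfp (\<lambda>S. sem w (v(x := S)) \<phi>)"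

lemma sem_mono:
  assumes "\<And>x. v x \<subseteq> v' x"
  shows "sem w v \<phi> \<subseteq> sem w v' \<phi>"
  using assms
proof (induction \<phi> arbitrary: v v')
  case (Var x)
  from Var[of x] show ?case by auto
next
  case (Modal M \<phi>)
  from Modal.IH[of v v', OF Modal.prems] show ?case by auto
next
  case (Or \<phi> \<psi>)
  from Or.IH(1)[of v v', OF Or.prems] Or.IH(2)[of v v', OF Or.prems] show ?case by auto
next
  case (And \<phi> \<psi>)
  from And.IH(1)[of v v', OF And.prems] And.IH(2)[of v v', OF And.prems] show ?case by auto
next
  case (Mu x \<phi>)
  have "sem w (v(x := S)) \<phi> \<subseteq> sem w (v'(x := S)) \<phi>" for S
    by (rule Mu.IH) (simp add: Mu.prems)
  then show ?case unfolding sem.simps by (rule lfp_mono)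
next
  case (Nu x \<phi>)
  have "sem w (v(x := S)) \<phi> \<subseteq> sem w (v'(x := S)) \<phi>" for S
    by (rule Nu.IH) (simp add: Nu.prems)
  then show ?case unfolding sem.simps by (rule gfp_mono)
qed simp_all

lemma mono_sem_upd: "mono (\<lambda>S. sem w (v(x := S)) \<phi>)"
  by (intro monoI sem_mono) simp

lemma sem_subset_positions: "sem w v \<phi> \<subseteq> positions w"
proof (induction \<phi> arbitrary: v)
  case (Or \<phi> \<psi>)
  from Or.IH(1)[of v] Or.IH(2)[of v] show ?case by simp
next
  case (And \<phi> \<psi>)
  from And.IH(1)[of v] show ?case by auto
next
  case (Mu x \<phi>)
  show ?case unfolding sem.simps by (rule lfp_lowerbound) (rule Mu.IH)
next
  case (Nu x \<phi>)
  have "S \<subseteq> positions w" if "S \<subseteq> sem w (v(x := S)) \<phi>" for S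
    using that Nu.IH by (rule order_trans)
  then show ?case unfolding sem.simps by (rule gfp_least)
qed auto

fun free_vars :: "'a fml \<Rightarrow> nat set" where
  "free_vars (Var x) = {x}"
| "free_vars (Atom A) = {}"
| "free_vars (NegAtom A) = {}"
| "free_vars (Modal M \<phi>) = free_vars \<phi>"
| "free_vars (Or \<phi> \<psi>) = free_vars \<phi> \<union> free_vars \<psi>"
| "free_vars (And \<phi> \<psi>) = free_vars \<phi> \<union> free_vars \<psi>"
| "free_vars (Mu x \<phi>) = free_vars \<phi> - {x}"
| "free_vars (Nu x \<phi>) = free_vars \<phi> - {x}"

definition sentence :: "'a fml \<Rightarrow> bool" where
  "sentence \<phi> \<longleftrightarrow> free_vars \<phi> = {}"

fun mu_fragment :: "'a fml \<Rightarrow> bool" where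
  "mu_fragment (Var x) \<longleftrightarrow> True"
| "mu_fragment (Atom A) \<longleftrightarrow> True"
| "mu_fragment (NegAtom A) \<longleftrightarrow> True"
| "mu_fragment (Modal M \<phi>) \<longleftrightarrow> mu_fragment \<phi>"
| "mu_fragment (Or \<phi> \<psi>) \<longleftrightarrow> mu_fragment \<phi> \<and> mu_fragment \<psi>"
| "mu_fragment (And \<phi> \<psi>) \<longleftrightarrow> mu_fragment \<phi> \<and> mu_fragment \<psi>"
| "mu_fragment (Mu x \<phi>) \<longleftrightarrow> mu_fragment \<phi>"
| "mu_fragment (Nu x \<phi>) \<longleftrightarrow> False"

text \<open>
  For sentences the valuation is irrelevant.  The empty word has no position 1 and satisfies no
  sentence.
\<close>

definition models :: "('a, 'd) data_word \<Rightarrow> 'a fml \<Rightarrow> bool" (infix "\<Turnstile>" 50) where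
  "w \<Turnstile> \<phi> \<longleftrightarrow> 1 \<in> sem w (\<lambda>_. {}) \<phi>"

text \<open>The letters that occur in a formula are the elements of \<^term>\<open>set_fml \<phi>\<close>.\<close>

definition satisfiable :: "'a set \<Rightarrow> 'd set \<Rightarrow> 'a fml \<Rightarrow> bool" where
  "satisfiable \<Sigma> D \<phi> \<longleftrightarrow> (\<exists>w \<in> lists (\<Sigma> \<times> D). w \<Turnstile> \<phi>)"


section \<open>Decidability\<close>

text \<open>
  Partial recursive functions in Kleene's sense, with a big-step semantics:
  \<open>computes f xs y\<close> means that \<open>f\<close> is defined on the arguments \<open>xs\<close>, with value \<open>y\<close>.
\<close>

datatype recf =
    Zero
  | Succ
  | Proj nat
  | Comp recf "recf list"
  | PrimRec recf recf
  | Minim recf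

inductive computes :: "recf \<Rightarrow> nat list \<Rightarrow> nat \<Rightarrow> bool" where
  zero: "computes Zero xs 0"
| succ: "computes Succ [x] (Suc x)"
| proj: "i < length xs \<Longrightarrow> computes (Proj i) xs (xs ! i)"
| comp: "list_all2 (\<lambda>g y. computes g xs y) gs ys \<Longrightarrow> computes f ys z
    \<Longrightarrow> computes (Comp f gs) xs z"
| primrec_0: "computes f xs y \<Longrightarrow> computes (PrimRec f g) (0 # xs) y"
| primrec_Suc: "computes (PrimRec f g) (n # xs) r \<Longrightarrow> computes g (n # r # xs) y
    \<Longrightarrow> computes (PrimRec f g) (Suc n # xs) y"
| minim: "computes f (n # xs) 0 \<Longrightarrow> (\<And>m. m < n \<Longrightarrow> \<exists>y. computes f (m # xs) (Suc y))
    \<Longrightarrow> computes (Minim f) xs n"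

inductive_cases computes_ZeroE: "computes Zero xs z"
inductive_cases computes_SuccE: "computes Succ xs z"
inductive_cases computes_ProjE: "computes (Proj i) xs z"
inductive_cases computes_CompE: "computes (Comp f gs) xs z"
inductive_cases computes_PrimRec_0E: "computes (PrimRec f g) (0 # xs) z"
inductive_cases computes_PrimRec_SucE: "computes (PrimRec f g) (Suc n # xs) z"
inductive_cases computes_MinimE: "computes (Minim f) xs z"

lemma computes_deterministic: "computes f xs y \<Longrightarrow> computes f xs z \<Longrightarrow> y = z"
proof (induction arbitrary: z rule: computes.induct)
  case (zero xs)
  then show ?case by (elim computes_ZeroE) simp
next
  case (succ x)
  then show ?case by (elim computes_SuccE) simp
next
  case (proj i xs)
  then show ?case by (elim computes_ProjE) simp
next
  case (comp xs gs ys f u)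
  from comp.prems obtain ys' where
    ys': "list_all2 (\<lambda>g y. computes g xs y) gs ys'" "computes f ys' z"
    by (rule computes_CompE)
  have "ys = ys'"
    using comp.IH(1) ys'(1)
    by (intro nth_equalityI) (auto simp: list_all2_conv_all_nth)
  with comp.IH(2) ys'(2) show ?case by simp
next
  case (primrec_0 f xs y g)
  then show ?case by (blast elim: computes_PrimRec_0E)
next
  case (primrec_Suc f g n xs r y)
  from primrec_Suc.prems obtain r' where
    r': "computes (PrimRec f g) (n # xs) r'" "computes g (n # r' # xs) z"
    by (rule computes_PrimRec_SucE)
  from primrec_Suc.IH(1)[OF r'(1)] r'(2) show ?case
    by (intro primrec_Suc.IH(2)) simp
next
  case (minim f n xs)
  from minim.prems have z: "computes f (z # xs) 0"
    and below: "\<And>m. m < z \<Longrightarrow> \<exists>y. computes f (m # xs) (Suc y)"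
    by (elim computes_MinimE; blast)+
  show ?case
  proof (cases n z rule: linorder_cases)
    case less
    from below[OF less] obtain y where "computes f (n # xs) (Suc y)" ..
    from minim.IH(1)[OF this] show ?thesis by simp
  next
    case greater
    from minim.IH(2)[OF greater] z show ?thesis by blast
  qed
qed

text \<open>
  A problem consists of a set \<open>I\<close> of instances, presented to the algorithm through the coding
  \<open>code\<close>, and the property \<open>Q\<close> to be decided.  The algorithm has to halt with the right answer
  on every instance; nothing is required on numbers that do not code an instance.
\<close>

definition decidable_problem :: "('i \<Rightarrow> nat) \<Rightarrow> 'i set \<Rightarrow> ('i \<Rightarrow> bool) \<Rightarrow> bool" where
  "decidable_problem code I Q \<longleftrightarrow>
     (\<exists>f. \<forall>x \<in> I. computes f [code x] (if Q x then 1 else 0))"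


section \<open>Goedel numbering of the instances\<close>

fun atom_code :: "nat atom \<Rightarrow> nat" where
  "atom_code SuccSame = 0"
| "atom_code PredSame = 1"
| "atom_code FirstG = 2"
| "atom_code LastG = 3"
| "atom_code FirstC = 4"
| "atom_code LastC = 5"
| "atom_code (Letter a) = 6 + a"

fun modality_code :: "modality \<Rightarrow> nat" where
  "modality_code XG = 0"
| "modality_code XC = 1"
| "modality_code YG = 2"
| "modality_code YC = 3"

fun fml_code :: "nat fml \<Rightarrow> nat" where
  "fml_code (Var x) = prod_encode (0, x)"
| "fml_code (Atom A) = prod_encode (1, atom_code A)"
| "fml_code (NegAtom A) = prod_encode (2, atom_code A)"
| "fml_code (Modal M \<phi>) = prod_encode (3, prod_encode (modality_code M, fml_code \<phi>))"
| "fml_code (Or \<phi> \<psi>) = prod_encode (4, prod_encode (fml_code \<phi>, fml_code \<psi>))"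
| "fml_code (And \<phi> \<psi>) = prod_encode (5, prod_encode (fml_code \<phi>, fml_code \<psi>))"
| "fml_code (Mu x \<phi>) = prod_encode (6, prod_encode (x, fml_code \<phi>))"
| "fml_code (Nu x \<phi>) = prod_encode (7, prod_encode (x, fml_code \<phi>))"

text \<open>
  The alphabet is part of the instance.  Up to renaming of letters it is an initial segment
  \<open>{..<k}\<close> of the naturals, and it is then coded by its size \<open>k\<close>.
\<close>

definition mu_instances :: "(nat \<times> nat fml) set" where
  "mu_instances = {(k, \<phi>). set_fml \<phi> \<subseteq> {..<k} \<and> sentence \<phi> \<and> mu_fragment \<phi>}"

definition instance_code :: "nat \<times> nat fml \<Rightarrow> nat" where
  "instance_code = (\<lambda>(k, \<phi>). prod_encode (k, fml_code \<phi>))"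

lemma inj_atom_code: "inj atom_code"
proof (rule injI)
  show "atom_code A = atom_code B \<Longrightarrow> A = B" for A B
    by (cases A; cases B) auto
qed

lemma inj_modality_code: "inj modality_code"
proof (rule injI)
  show "modality_code M = modality_code N \<Longrightarrow> M = N" for M N
    by (cases M; cases N) auto
qed

lemma inj_fml_code: "inj fml_code"
proof (rule injI)
  show "fml_code \<phi> = fml_code \<psi> \<Longrightarrow> \<phi> = \<psi>" for \<phi> \<psi>
  proof (induction \<phi> arbitrary: \<psi>)
    case (Var x) then show ?case by (cases \<psi>) auto
  next
    case (Atom A) then show ?case by (cases \<psi>) (auto simp: inj_eq[OF inj_atom_code])
  next
    case (NegAtom A) then show ?case by (cases \<psi>) (auto simp: inj_eq[OF inj_atom_code])
  next
    case (Modal M \<phi>) then show ?case by (cases \<psi>) (auto simp: inj_eq[OF inj_modality_code])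
  next
    case (Or \<phi>1 \<phi>2) then show ?case by (cases \<psi>) auto
  next
    case (And \<phi>1 \<phi>2) then show ?case by (cases \<psi>) auto
  next
    case (Mu x \<phi>) then show ?case by (cases \<psi>) auto
  next
    case (Nu x \<phi>) then show ?case by (cases \<psi>) auto
  qed
qed

lemma inj_instance_code: "inj instance_code"
  unfolding instance_code_def by (intro injI) (auto simp: inj_eq[OF inj_fml_code])

end

(*
  A run of a counter program is a sequence of increments, decrements and tests for zero.  As a data
  word, every decrement is the class successor of an increment of the same counter; the sequence is
  executable iff, in addition, the increments before a test of their counter are all matched, and
  matched before the test.  That no class crosses the test is a well-foundedness condition: a decrement after a test, linked to an increment before the test,
  closes a cycle "go forward, then to the class predecessor", and a least fixpoint forbids cycles.
  The programs are regular expressions over the actions, so that their control flow is expressed by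
  least fixpoints as well, and they compute all partial recursive functions.

  A formula that expresses halting on input n is obtained from the formula of the program by putting
  n increments in front of it.  This is computable on codes, hence a decision procedure, compiled
  into a program that halts iff the answer is "unsatisfiable", leads to a contradiction when it is
  run on the code of its own formula.
*)
theory Submission imports Defs begin

section \<open>Regular programs on counters\<close>

datatype act = Inc nat | Dec nat | Test nat

datatype prog = Skip | Act act | Seq prog prog | Star prog

type_synonym state = "nat \<Rightarrow> nat"

fun step :: "act \<Rightarrow> state \<Rightarrow> state \<Rightarrow> bool" where
  "step (Inc r) s s' \<longleftrightarrow> s' = s(r := Suc (s r))"
| "step (Dec r) s s' \<longleftrightarrow> s r \<noteq> 0 \<and> s' = s(r := s r - 1)"
| "step (Test r) s s' \<longleftrightarrow> s r = 0 \<and> s' = s"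

fun run :: "act list \<Rightarrow> state \<Rightarrow> state \<Rightarrow> bool" where
  "run [] s s' \<longleftrightarrow> s' = s"
| "run (a # as) s s' \<longleftrightarrow> (\<exists>s1. step a s s1 \<and> run as s1 s')"

fun lang :: "prog \<Rightarrow> act list set" where
  "lang Skip = {[]}"
| "lang (Act a) = {[a]}"
| "lang (Seq p q) = {as @ bs |as bs. as \<in> lang p \<and> bs \<in> lang q}"
| "lang (Star p) = concat ` lists (lang p)"

definition exec :: "prog \<Rightarrow> state \<Rightarrow> state \<Rightarrow> bool" where
  "exec p s s' \<longleftrightarrow> (\<exists>as \<in> lang p. run as s s')"

lemma run_append: "run (as @ bs) s s' \<longleftrightarrow> (\<exists>s1. run as s s1 \<and> run bs s1 s')"
  by (induction as arbitrary: s) auto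

lemma exec_Skip [simp]: "exec Skip s s' \<longleftrightarrow> s' = s"
  by (simp add: exec_def)

lemma exec_Act [simp]: "exec (Act a) s s' \<longleftrightarrow> step a s s'"
  by (simp add: exec_def)

lemma exec_Seq: "exec (Seq p q) s s' \<longleftrightarrow> (\<exists>s1. exec p s s1 \<and> exec q s1 s')"
  by (fastforce simp: exec_def run_append)

lemma exec_Star: "exec (Star p) s s' \<longleftrightarrow> (exec p)\<^sup>*\<^sup>* s s'"
proof
  assume "exec (Star p) s s'"
  then obtain ass where "set ass \<subseteq> lang p" "run (concat ass) s s'"
    by (auto simp: exec_def)
  then show "(exec p)\<^sup>*\<^sup>* s s'"
  proof (induction ass arbitrary: s)
    case (Cons as ass)
    then obtain s1 where "run as s s1" "run (concat ass) s1 s'"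
      by (auto simp: run_append)
    with Cons show ?case
      by (auto simp: exec_def intro: converse_rtranclp_into_rtranclp)
  qed simp
next
  assume "(exec p)\<^sup>*\<^sup>* s s'"
  then show "exec (Star p) s s'"
  proof (induction rule: converse_rtranclp_induct)
    case base
    show ?case unfolding exec_def lang.simps by (rule bexI[of _ "concat []"]) (simp, rule imageI, simp)
  next
    case (step s s1)
    from step.hyps(1) obtain as where as: "as \<in> lang p" "run as s s1" by (auto simp: exec_def)
    from step.IH obtain ass where ass: "set ass \<subseteq> lang p" "run (concat ass) s1 s'"
      by (auto simp: exec_def)
    have "concat (as # ass) \<in> lang (Star p)"
      unfolding lang.simps using as(1) ass(1) by (intro imageI) auto
    moreover have "run (concat (as # ass)) s s'" using as(2) ass(2) by (auto simp: run_append)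
    ultimately show ?case unfolding exec_def by blast
  qed
qed

text \<open>The star may stop after any number of rounds, but the closing test blocks every exit
  with \<open>r\<close> nonzero, and \<open>Dec r\<close> blocks a further round once
  \<open>r\<close> is zero. The nondeterministic expression thus behaves like a loop whose guard
  consumes one unit of \<open>r\<close> per round.\<close>

definition while :: "nat \<Rightarrow> prog \<Rightarrow> prog" where
  "while r p = Seq (Star (Seq (Act (Dec r)) p)) (Act (Test r))"

lemma exec_while_rtranclp:
  "exec (while r p) s s' \<longleftrightarrow> (exec (Seq (Act (Dec r)) p))\<^sup>*\<^sup>* s s' \<and> s' r = 0"
  by (auto simp: while_def exec_Seq exec_Star)

lemma exec_while:
  "exec (while r p) s s' \<longleftrightarrow>
     (if s r = 0 then s' = s
      else \<exists>s1. exec p (s(r := s r - 1)) s1 \<and> exec (while r p) s1 s')"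
proof -
  let ?R = "exec (Seq (Act (Dec r)) p)"
  have R: "?R s s1 \<longleftrightarrow> s r \<noteq> 0 \<and> exec p (s(r := s r - 1)) s1" for s1
    by (auto simp: exec_Seq)
  have "?R\<^sup>*\<^sup>* s s' \<longleftrightarrow> s' = s \<or> (\<exists>s1. ?R s s1 \<and> ?R\<^sup>*\<^sup>* s1 s')"
    by (metis converse_rtranclp_into_rtranclp converse_rtranclpE rtranclp.rtrancl_refl)
  then show ?thesis unfolding exec_while_rtranclp R by auto
qed

text \<open>The test directly follows an increment of the same counter, so no run exists. The
  compiler uses it for calls with a wrong number of arguments, which have no value.\<close>

definition fail :: prog where
  "fail = Seq (Act (Inc 0)) (Act (Test 0))"

lemma exec_fail [simp]: "\<not> exec fail s s'"
  by (simp add: fail_def exec_Seq)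

section \<open>Elementary register operations\<close>

definition clear :: "nat \<Rightarrow> prog" where
  "clear r = while r Skip"

lemma exec_clear [simp]: "exec (clear r) s s' \<longleftrightarrow> s' = s(r := 0)"
proof (induction "s r" arbitrary: s)
  case 0
  then show ?case unfolding clear_def by (subst exec_while) (simp add: fun_upd_idem)
next
  case (Suc n)
  from Suc.hyps(2) have n: "s r - 1 = n" "s r \<noteq> 0" by simp_all
  have "exec (clear r) s s' \<longleftrightarrow> exec (clear r) (s(r := n)) s'"
    unfolding clear_def using n by (subst exec_while) simp
  also have "\<dots> \<longleftrightarrow> s' = s(r := 0)"
    by (subst Suc.hyps(1)) simp_all
  finally show ?case .
qed

definition move :: "nat \<Rightarrow> nat \<Rightarrow> prog" where
  "move r t = while r (Act (Inc t))"

lemma exec_move: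
  assumes "r \<noteq> t"
  shows "exec (move r t) s s' \<longleftrightarrow> s' = s(r := 0, t := s t + s r)"
proof (induction "s r" arbitrary: s)
  case 0
  then show ?case unfolding move_def by (subst exec_while) (simp add: fun_upd_idem)
next
  case (Suc n)
  from Suc.hyps(2) have n: "s r - 1 = n" "s r \<noteq> 0" by simp_all
  have "exec (move r t) s s' \<longleftrightarrow> exec (move r t) (s(r := n, t := Suc (s t))) s'"
    unfolding move_def using n assms by (subst exec_while) auto
  also have "\<dots> \<longleftrightarrow> s' = (s(r := n, t := Suc (s t)))(r := 0, t := Suc (s t) + n)"
    using assms by (subst Suc.hyps(1)) simp_all
  finally show ?case using Suc.hyps(2) assms by (auto simp: fun_upd_twist)
qed

definition split2 :: "nat \<Rightarrow> nat \<Rightarrow> nat \<Rightarrow> prog" where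
  "split2 r u t = while r (Seq (Act (Inc u)) (Act (Inc t)))"

lemma exec_split2:
  assumes "r \<noteq> t" "r \<noteq> u" "u \<noteq> t"
  shows "exec (split2 r u t) s s' \<longleftrightarrow> s' = s(r := 0, u := s u + s r, t := s t + s r)"
proof (induction "s r" arbitrary: s)
  case 0
  then show ?case unfolding split2_def by (subst exec_while) (simp add: fun_upd_idem)
next
  case (Suc n)
  from Suc.hyps(2) have n: "s r - 1 = n" "s r \<noteq> 0" by simp_all
  have "exec (split2 r u t) s s' \<longleftrightarrow>
      exec (split2 r u t) (s(r := n, u := Suc (s u), t := Suc (s t))) s'"
    unfolding split2_def using n assms by (subst exec_while) (auto simp: exec_Seq)
  also have "\<dots> \<longleftrightarrow>
      s' = (s(r := n, u := Suc (s u), t := Suc (s t)))(r := 0, u := Suc (s u) + n, t := Suc (s t) + n)"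
    using assms by (subst Suc.hyps(1)) simp_all
  also have "(s(r := n, u := Suc (s u), t := Suc (s t)))(r := 0, u := Suc (s u) + n, t := Suc (s t) + n)
      = s(r := 0, u := s u + s r, t := s t + s r)"
    using assms Suc.hyps(2)[symmetric] by (intro ext) simp
  finally show ?case .
qed

text \<open>Reading a counter by a loop destroys it, so the value is first duplicated into
  \<open>t\<close> and the scratch register \<open>u\<close>, then moved back from
  \<open>u\<close>.\<close>

definition copy :: "nat \<Rightarrow> nat \<Rightarrow> nat \<Rightarrow> prog" where
  "copy r t u = Seq (split2 r u t) (move u r)"

lemma exec_copy:
  assumes "r \<noteq> t" "r \<noteq> u" "u \<noteq> t" "s u = 0" "s t = 0"
  shows "exec (copy r t u) s s' \<longleftrightarrow> s' = s(t := s r)"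
proof -
  have "exec (copy r t u) s s' \<longleftrightarrow> s' =
      (s(r := 0, u := s u + s r, t := s t + s r))(u := 0, r := s u + s r)"
    using assms by (simp add: copy_def exec_Seq exec_split2 exec_move)
  also have "(s(r := 0, u := s u + s r, t := s t + s r))(u := 0, r := s u + s r) = s(t := s r)"
    using assms by (intro ext) simp
  finally show ?thesis .
qed

fun clears :: "nat \<Rightarrow> nat \<Rightarrow> prog" where
  "clears j 0 = Skip"
| "clears j (Suc n) = Seq (clear j) (clears (Suc j) n)"

lemma exec_clears:
  "exec (clears j n) s s' \<longleftrightarrow> s' = (\<lambda>r. if j \<le> r \<and> r < j + n then 0 else s r)"
proof (induction n arbitrary: j s)
  case (Suc n)
  have "(\<lambda>r. if Suc j \<le> r \<and> r < Suc j + n then 0 else (s(j := 0)) r) =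
      (\<lambda>r. if j \<le> r \<and> r < j + Suc n then 0 else s r)"
    by (intro ext) auto
  then show ?case by (simp add: exec_Seq Suc)
next
  case 0
  have "(\<lambda>r. if j \<le> r \<and> r < j + 0 then 0 else s r) = s" by (intro ext) simp
  then show ?case by simp
qed


section \<open>Compiling recursive functions\<close>

text \<open>
  The arguments are read from the registers \<open>rs\<close>, the value is left in \<open>t\<close>, and the registers
  from \<open>b\<close> on are scratch, zero before and after the run.
\<close>

fun compile :: "recf \<Rightarrow> nat list \<Rightarrow> nat \<Rightarrow> nat \<Rightarrow> prog"
  and compiles :: "recf list \<Rightarrow> nat list \<Rightarrow> nat \<Rightarrow> nat \<Rightarrow> prog"
where
  "compile Zero rs t b = Skip"
| "compile Succ rs t b =
    (if length rs = 1 then Seq (copy (hd rs) t b) (Act (Inc t)) else fail)"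
| "compile (Proj i) rs t b = (if i < length rs then copy (rs ! i) t b else fail)"
| "compile (Comp f gs) rs t b =
    Seq (compiles gs rs b (b + length gs))
      (Seq (compile f [b..<b + length gs] t (b + length gs)) (clears b (length gs)))"
| "compile (PrimRec f g) rs t b =
    (if rs = [] then fail else
      Seq (compile f (tl rs) t b)
        (Seq (copy (hd rs) (Suc b) b)
          (Seq (while (Suc b)
                (Seq (compile g (b # t # tl rs) (Suc (Suc b)) (Suc (Suc (Suc b))))
                  (Seq (clear t) (Seq (move (Suc (Suc b)) t) (Act (Inc b))))))
            (clear b))))"
| "compile (Minim f) rs t b =
    Seq (compile f (t # rs) b (Suc b))
      (while b (Seq (clear b) (Seq (Act (Inc t)) (compile f (t # rs) b (Suc b)))))"
| "compiles [] rs j b = Skip"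
| "compiles (g # gs) rs j b = Seq (compile g rs j b) (compiles gs rs (Suc j) b)"

fun store :: "state \<Rightarrow> nat \<Rightarrow> nat list \<Rightarrow> state" where
  "store s j [] = s"
| "store s j (y # ys) = store (s(j := y)) (Suc j) ys"

lemma store_outside: "r < j \<or> j + length ys \<le> r \<Longrightarrow> store s j ys r = s r"
  by (induction ys arbitrary: s j) auto

lemma map_store: "map (store s j ys) [j..<j + length ys] = ys"
proof (induction ys arbitrary: s j)
  case (Cons y ys)
  have "map (store (s(j := y)) (Suc j) ys) [Suc j..<j + Suc (length ys)] = ys"
    using Cons[of "s(j := y)" "Suc j"] unfolding add_Suc_shift .
  moreover have "[j..<j + Suc (length ys)] = j # [Suc j..<j + Suc (length ys)]"
    by (rule upt_conv_Cons) simp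
  ultimately show ?case by (simp add: store_outside del: upt_Suc)
qed simp

text \<open>An equivalence is needed, since undefinedness has to show as the absence of runs. Fixing
  the whole final state also leaves the arguments intact and the scratch registers zero, which lets
  compiled pieces be chained.\<close>

definition correct :: "recf \<Rightarrow> bool" where
  "correct f \<longleftrightarrow> (\<forall>rs t b s s'. (\<forall>r \<in> set rs. r < b) \<longrightarrow> t < b \<longrightarrow> t \<notin> set rs \<longrightarrow>
     (\<forall>r \<ge> b. s r = 0) \<longrightarrow> s t = 0 \<longrightarrow>
     (exec (compile f rs t b) s s' \<longleftrightarrow> (\<exists>y. computes f (map s rs) y \<and> s' = s(t := y))))"

lemma correctD:
  "\<lbrakk>correct f; \<forall>r \<in> set rs. r < b; t < b; t \<notin> set rs; \<forall>r \<ge> b. s r = 0; s t = 0\<rbrakk> \<Longrightarrow>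
   exec (compile f rs t b) s s' \<longleftrightarrow> (\<exists>y. computes f (map s rs) y \<and> s' = s(t := y))"
  unfolding correct_def by blast

lemma ex_image_eq: "(\<exists>x. (\<exists>y. P y \<and> x = f y) \<and> Q x) \<longleftrightarrow> (\<exists>y. P y \<and> Q (f y))"
  by blast

text \<open>Results go to consecutive registers from \<open>j\<close> on, above all argument
  registers, so storing one does not disturb the arguments of the next call; scratch starts above
  the whole block.\<close>

lemma exec_compiles:
  assumes "\<forall>g \<in> set gs. correct g" "\<forall>r \<in> set rs. r < j" "j + length gs \<le> b" "\<forall>r \<ge> j. s r = 0"
  shows "exec (compiles gs rs j b) s s' \<longleftrightarrow>
    (\<exists>ys. list_all2 (\<lambda>g y. computes g (map s rs) y) gs ys \<and> s' = store s j ys)"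
  using assms
proof (induction gs arbitrary: j s)
  case (Cons g gs)
  have 1: "exec (compile g rs j b) s s1 \<longleftrightarrow> (\<exists>y. computes g (map s rs) y \<and> s1 = s(j := y))" for s1
    by (rule correctD) (use Cons.prems in auto)
  have 2: "exec (compiles gs rs (Suc j) b) (s(j := y)) s' \<longleftrightarrow>
      (\<exists>ys. list_all2 (\<lambda>g y. computes g (map s rs) y) gs ys \<and> s' = store (s(j := y)) (Suc j) ys)" for y
  proof -
    have rs: "map (s(j := y)) rs = map s rs" using Cons.prems by auto
    have "\<forall>r \<in> set rs. r < Suc j" using Cons.prems(2) by auto
    then have "exec (compiles gs rs (Suc j) b) (s(j := y)) s' \<longleftrightarrow>
      (\<exists>ys. list_all2 (\<lambda>g z. computes g (map (s(j := y)) rs) z) gs ys \<and>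
        s' = store (s(j := y)) (Suc j) ys)"
      using Cons.prems by (intro Cons.IH) auto
    then show ?thesis unfolding rs .
  qed
  have "exec (compiles (g # gs) rs j b) s s' \<longleftrightarrow> (\<exists>y. computes g (map s rs) y \<and>
      (\<exists>ys. list_all2 (\<lambda>g y. computes g (map s rs) y) gs ys \<and> s' = store s j (y # ys)))"
    unfolding compiles.simps exec_Seq store.simps 1 2[symmetric] by (rule ex_image_eq)
  then show ?case unfolding list_all2_Cons1 by blast
qed simp

section \<open>Evaluation rules as equivalences\<close>

lemma computes_Zero_iff [simp]: "computes Zero xs y \<longleftrightarrow> y = 0"
  by (auto intro: computes.zero elim: computes_ZeroE)

lemma computes_Succ_iff: "computes Succ xs y \<longleftrightarrow> length xs = 1 \<and> y = Suc (hd xs)"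
  by (cases xs) (auto intro: computes.succ elim: computes_SuccE)

lemma computes_Proj_iff: "computes (Proj i) xs y \<longleftrightarrow> i < length xs \<and> y = xs ! i"
  by (auto intro: computes.proj elim: computes_ProjE)

lemma computes_Comp_iff:
  "computes (Comp f gs) xs z \<longleftrightarrow>
    (\<exists>ys. list_all2 (\<lambda>g y. computes g xs y) gs ys \<and> computes f ys z)"
  by (auto intro: computes.comp elim: computes_CompE)

inductive_cases computes_PrimRecE: "computes (PrimRec f g) xs z"

lemma not_computes_PrimRec_Nil [simp]: "\<not> computes (PrimRec f g) [] z"
  by (auto elim: computes_PrimRecE)

lemma computes_PrimRec_0_iff: "computes (PrimRec f g) (0 # xs) y \<longleftrightarrow> computes f xs y"
  by (auto intro: computes.primrec_0 elim: computes_PrimRec_0E)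

lemma computes_PrimRec_Suc_iff:
  "computes (PrimRec f g) (Suc n # xs) y \<longleftrightarrow>
    (\<exists>r. computes (PrimRec f g) (n # xs) r \<and> computes g (n # r # xs) y)"
  by (auto intro: computes.primrec_Suc elim: computes_PrimRec_SucE)

text \<open>Evaluation at a larger recursion argument passes through all smaller ones. This supplies
  the intermediate values that the loop of a compiled recursion needs.\<close>

lemma computes_PrimRec_less:
  "computes (PrimRec f g) ((n + m) # xs) z \<Longrightarrow> \<exists>y. computes (PrimRec f g) (n # xs) y"
  by (induction m arbitrary: z) (auto simp: computes_PrimRec_Suc_iff)

lemma computes_Minim_iff:
  "computes (Minim f) xs n \<longleftrightarrow>
    computes f (n # xs) 0 \<and> (\<forall>m < n. \<exists>y. computes f (m # xs) (Suc y))"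
  by (auto intro: computes.minim elim: computes_MinimE)

lemma correct_Comp:
  assumes f: "correct f" and gs: "\<And>g. g \<in> set gs \<Longrightarrow> correct g"
  shows "correct (Comp f gs)"
  unfolding correct_def
proof (intro allI impI)
  fix rs :: "nat list" and t b :: nat and s s' :: state
  assume A: "\<forall>r \<in> set rs. r < b" "t < b" "t \<notin> set rs" "\<forall>r \<ge> b. s r = 0" "s t = (0::nat)"
  let ?n = "length gs"
  have 1: "exec (compiles gs rs b (b + ?n)) s s1 \<longleftrightarrow>
    (\<exists>ys. list_all2 (\<lambda>g y. computes g (map s rs) y) gs ys \<and> s1 = store s b ys)" for s1
    by (rule exec_compiles) (use A gs in auto)
  have 2: "exec (compile f [b..<b + ?n] t (b + ?n)) (store s b ys) s1 \<longleftrightarrow>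
    (\<exists>y. computes f ys y \<and> s1 = (store s b ys)(t := y))" if "length ys = ?n" for ys s1
  proof -
    have "map (store s b ys) [b..<b + ?n] = ys" using map_store[of s b ys] that by simp
    moreover have "exec (compile f [b..<b + ?n] t (b + ?n)) (store s b ys) s1 \<longleftrightarrow>
      (\<exists>y. computes f (map (store s b ys) [b..<b + ?n]) y \<and> s1 = (store s b ys)(t := y))"
      by (rule correctD) (use A f that in \<open>auto simp: store_outside\<close>)
    ultimately show ?thesis by simp
  qed
  \<comment> \<open>Zeroing the block of intermediate results restores the scratch registers, so
    that only \<open>t\<close> has changed.\<close>
  have 3: "(\<lambda>r. if b \<le> r \<and> r < b + ?n then 0 else ((store s b ys)(t := y)) r) = s(t := y)"
    if "length ys = ?n" for ys y
    using A that by (intro ext, auto simp: store_outside)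
  show "exec (compile (Comp f gs) rs t b) s s' \<longleftrightarrow>
      (\<exists>y. computes (Comp f gs) (map s rs) y \<and> s' = s(t := y))" (is "?L \<longleftrightarrow> ?R")
  proof
    assume ?L
    then obtain ys y where ys: "list_all2 (\<lambda>g y. computes g (map s rs) y) gs ys"
      and y: "computes f ys y" and s': "exec (clears b ?n) ((store s b ys)(t := y)) s'"
      unfolding compile.simps exec_Seq 1 using 2 by (metis list_all2_lengthD)
    from ys have len: "length ys = ?n" by (simp add: list_all2_lengthD)
    from s' have "s' = s(t := y)" unfolding exec_clears 3[OF len] .
    with ys y show ?R by (auto simp: computes_Comp_iff)
  next
    assume ?R
    then obtain ys y where ys: "list_all2 (\<lambda>g y. computes g (map s rs) y) gs ys"
      and y: "computes f ys y" and s': "s' = s(t := y)"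
      by (auto simp: computes_Comp_iff)
    from ys have len: "length ys = ?n" by (simp add: list_all2_lengthD)
    have "exec (compiles gs rs b (b + ?n)) s (store s b ys)" using 1 ys by blast
    moreover have "exec (compile f [b..<b + ?n] t (b + ?n)) (store s b ys) ((store s b ys)(t := y))"
      using 2[OF len] y by blast
    moreover have "exec (clears b ?n) ((store s b ys)(t := y)) s'"
      unfolding exec_clears 3[OF len] s' ..
    ultimately show ?L unfolding compile.simps exec_Seq by blast
  qed
qed

text \<open>Register \<open>b\<close> counts the rounds done, \<open>Suc b\<close> those still to
  do, \<open>t\<close> holds the value reached, and \<open>Suc (Suc b)\<close> receives the next
  value before it replaces the one in \<open>t\<close>.\<close>

lemma correct_PrimRec:
  assumes f: "correct f" and g: "correct g"
  shows "correct (PrimRec f g)"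
  unfolding correct_def
proof (intro allI impI)
  fix rs :: "nat list" and t b :: nat and s s' :: state
  assume A: "\<forall>r \<in> set rs. r < b" "t < b" "t \<notin> set rs" "\<forall>r \<ge> b. s r = 0" "s t = (0::nat)"
  show "exec (compile (PrimRec f g) rs t b) s s' \<longleftrightarrow>
      (\<exists>y. computes (PrimRec f g) (map s rs) y \<and> s' = s(t := y))"
  proof (cases rs)
    case Nil
    then show ?thesis by simp
  next
    case (Cons a qs)
    let ?h = "PrimRec f g"
    let ?B = "Seq (compile g (b # t # qs) (Suc (Suc b)) (Suc (Suc (Suc b))))
                  (Seq (clear t) (Seq (move (Suc (Suc b)) t) (Act (Inc b))))"
    define st where "st k m y = s(b := k, Suc b := m, t := y)" for k m y
    have qs: "map (st k m y) qs = map s qs" for k m y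
      using A Cons by (auto simp: st_def)
    have B: "exec ?B (st k m y) s1 \<longleftrightarrow>
        (\<exists>y'. computes g (k # y # map s qs) y' \<and> s1 = st (Suc k) m y')" for k m y s1
    proof -
      have 1: "exec (compile g (b # t # qs) (Suc (Suc b)) (Suc (Suc (Suc b)))) (st k m y) s2 \<longleftrightarrow>
        (\<exists>y'. computes g (map (st k m y) (b # t # qs)) y' \<and> s2 = (st k m y)(Suc (Suc b) := y'))" for s2
        by (rule correctD) (use A Cons g in \<open>auto simp: st_def\<close>)
      have 2: "map (st k m y) (b # t # qs) = k # y # map s qs"
        using qs A by (simp add: st_def)
      have 3: "exec (Seq (clear t) (Seq (move (Suc (Suc b)) t) (Act (Inc b))))
          ((st k m y)(Suc (Suc b) := y')) s1 \<longleftrightarrow> s1 = st (Suc k) m y'" for y'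
      proof -
        have "(st k m y)(Suc (Suc b) := y', t := 0, Suc (Suc b) := 0, t := y', b := Suc k) = st (Suc k) m y'"
          using A by (intro ext) (simp add: st_def)
        moreover have "st k m y b = k" using A by (simp add: st_def)
        ultimately show ?thesis using A by (simp add: exec_Seq exec_move)
      qed
      show ?thesis
        unfolding exec_Seq[of "compile g (b # t # qs) (Suc (Suc b)) (Suc (Suc (Suc b)))"] 1 2 ex_image_eq 3 ..
    qed
    \<comment> \<open>Loop invariant: \<open>t\<close> holds the value at \<open>k\<close>. With
      \<open>m\<close> rounds to go the loop ends with the value at \<open>k + m\<close>, or has no
      run if there is none.\<close>
    have W: "exec (while (Suc b) ?B) (st k m y) s1 \<longleftrightarrow>
        (\<exists>z. computes ?h ((k + m) # map s qs) z \<and> s1 = st (k + m) 0 z)"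
      if "computes ?h (k # map s qs) y" for k m y s1
      using that
    proof (induction m arbitrary: k y)
      case 0
      have [simp]: "st k 0 y (Suc b) = 0" using A by (simp add: st_def)
      show ?case using 0 computes_deterministic by (subst exec_while) auto
    next
      case (Suc m)
      have e: "st k (Suc m) y (Suc b) = Suc m" "(st k (Suc m) y)(Suc b := m) = st k m y"
        using A by (auto simp: st_def)
      have "exec (while (Suc b) ?B) (st k (Suc m) y) s1 \<longleftrightarrow>
          (\<exists>s2. exec ?B (st k m y) s2 \<and> exec (while (Suc b) ?B) s2 s1)"
        using e by (subst exec_while) simp
      also have "\<dots> \<longleftrightarrow> (\<exists>y'. computes g (k # y # map s qs) y' \<and>
          exec (while (Suc b) ?B) (st (Suc k) m y') s1)"
        unfolding B by blast
      also have "\<dots> \<longleftrightarrow> (\<exists>y'. computes g (k # y # map s qs) y' \<and>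
          (\<exists>z. computes ?h ((Suc k + m) # map s qs) z \<and> s1 = st (Suc k + m) 0 z))"
        using Suc.IH[of "Suc k"] Suc.prems by (metis computes_PrimRec_Suc_iff)
      also have "\<dots> \<longleftrightarrow> (\<exists>z. computes ?h ((k + Suc m) # map s qs) z \<and> s1 = st (k + Suc m) 0 z)"
      proof -
        \<comment> \<open>A value at \<open>Suc k + m\<close> presupposes one at
          \<open>Suc k\<close>, which by determinism is computed by \<open>g\<close> from the
          current \<open>y\<close>.\<close>
        have "\<exists>y'. computes g (k # y # map s qs) y'" if "computes ?h ((Suc k + m) # map s qs) z" for z
          using computes_PrimRec_less[OF that] Suc.prems computes_deterministic
          by (metis computes_PrimRec_Suc_iff)
        then show ?thesis by auto
      qed
      finally show ?case .
    qed
    have F: "exec (compile f qs t b) s s1 \<longleftrightarrow> (\<exists>y. computes f (map s qs) y \<and> s1 = s(t := y))" for s1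
      by (rule correctD) (use A Cons f in auto)
    have C: "exec (copy a (Suc b) b) (s(t := y)) s1 \<longleftrightarrow> s1 = st 0 (s a) y" for y s1
    proof -
      have "(s(t := y))(Suc b := s a) = st 0 (s a) y"
        using A by (intro ext) (simp add: st_def)
      moreover have "a \<noteq> t" using A Cons by auto
      ultimately show ?thesis using A Cons by (subst exec_copy) auto
    qed
    have Z: "(st k 0 z)(b := 0) = s(t := z)" for k z
      using A by (intro ext, auto simp: st_def)
    have "exec (compile ?h rs t b) s s' \<longleftrightarrow>
      (\<exists>s1. exec (compile f qs t b) s s1 \<and> (\<exists>s2. exec (copy a (Suc b) b) s1 s2 \<and>
        (\<exists>s3. exec (while (Suc b) ?B) s2 s3 \<and> exec (clear b) s3 s')))"
      by (simp only: Cons compile.simps list.sel list.distinct if_False exec_Seq[of "compile f qs t b"]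
          exec_Seq[of "copy a (Suc b) b"] exec_Seq[of "while (Suc b) ?B"])
    also have "\<dots> \<longleftrightarrow> (\<exists>y. computes f (map s qs) y \<and>
        (\<exists>s1. exec (while (Suc b) ?B) (st 0 (s a) y) s1 \<and> s' = s1(b := 0)))"
      unfolding F C exec_clear ex_image_eq by simp
    also have "\<dots> \<longleftrightarrow> (\<exists>y. computes f (map s qs) y \<and>
        (\<exists>z. computes ?h (s a # map s qs) z \<and> s' = s(t := z)))"
      using W[of 0] Z by (simp add: computes_PrimRec_0_iff) (metis Z)
    also have "\<dots> \<longleftrightarrow> (\<exists>z. computes ?h (s a # map s qs) z \<and> s' = s(t := z))"
      using computes_PrimRec_less[of f g 0 "s a" "map s qs"] by (auto simp: computes_PrimRec_0_iff)
    finally show ?thesis using Cons by simp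
  qed
qed

text \<open>The result register \<open>t\<close> holds the candidate, tried from zero upwards, and
  \<open>b\<close> the value of \<open>f\<close> at it. A nonzero value forces another round, zero
  forces the exit, and an undefined value blocks the run.\<close>

lemma correct_Minim:
  assumes f: "correct f"
  shows "correct (Minim f)"
  unfolding correct_def
proof (intro allI impI)
  fix rs :: "nat list" and t b :: nat and s s' :: state
  assume A: "\<forall>r \<in> set rs. r < b" "t < b" "t \<notin> set rs" "\<forall>r \<ge> b. s r = 0" "s t = (0::nat)"
  let ?P = "compile f (t # rs) b (Suc b)"
  let ?B = "Seq (Act (Dec b)) (Seq (clear b) (Seq (Act (Inc t)) ?P))"
  define st where "st k y = s(t := k, b := y)" for k y
  have P: "exec ?P (st k 0) s1 \<longleftrightarrow> (\<exists>y. computes f (k # map s rs) y \<and> s1 = st k y)" for k s1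
  proof -
    have "exec ?P (st k 0) s1 \<longleftrightarrow>
        (\<exists>y. computes f (map (st k 0) (t # rs)) y \<and> s1 = (st k 0)(b := y))"
      by (rule correctD) (use A f in \<open>auto simp: st_def\<close>)
    moreover have m: "map (st k 0) (t # rs) = k # map s rs" using A by (auto simp: st_def)
    moreover have u: "(st k 0)(b := y) = st k y" for y by (simp add: st_def)
    ultimately show ?thesis unfolding m u by blast
  qed
  have s0: "s = st 0 0" using A by (intro ext, auto simp: st_def)
  have B: "exec ?B (st k y) s1 \<longleftrightarrow>
      y \<noteq> 0 \<and> (\<exists>z. computes f (Suc k # map s rs) z \<and> s1 = st (Suc k) z)" for k y s1
  proof -
    have e: "st k y b = y" "(st k y)(b := 0) = st k 0" "st k y t = k" "t \<noteq> b"
      using A by (simp_all add: st_def)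
    have e': "(st k 0)(t := Suc k) = st (Suc k) 0"
      using A by (intro ext) (simp add: st_def)
    have "exec ?B (st k y) s1 \<longleftrightarrow> y \<noteq> 0 \<and> exec ?P (st (Suc k) 0) s1"
      by (simp add: exec_Seq e e')
    then show ?thesis unfolding P .
  qed
  have E: "exec (compile (Minim f) rs t b) s s' \<longleftrightarrow>
      (\<exists>y. computes f (0 # map s rs) y \<and> (exec ?B)\<^sup>*\<^sup>* (st 0 y) s' \<and> s' b = 0)"
    using P[of 0] s0 by (auto simp: exec_Seq[of ?P] exec_while_rtranclp)
  show "exec (compile (Minim f) rs t b) s s' \<longleftrightarrow>
      (\<exists>n. computes (Minim f) (map s rs) n \<and> s' = s(t := n))" (is "?L \<longleftrightarrow> ?R")
  proof
    assume ?L
    then obtain y0 where y0: "computes f (0 # map s rs) y0"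
      and steps: "(exec ?B)\<^sup>*\<^sup>* (st 0 y0) s'" and s': "s' b = 0"
      unfolding E by blast
    \<comment> \<open>Invariant: \<open>b\<close> holds the value at the current candidate, and all
      earlier candidates had nonzero values, since each round begins by decrementing
      \<open>b\<close>.\<close>
    from steps have "\<exists>k y. s' = st k y \<and> computes f (k # map s rs) y \<and>
        (\<forall>m < k. \<exists>z. computes f (m # map s rs) (Suc z))"
    proof (induction rule: rtranclp_induct)
      case base
      then show ?case using y0 by blast
    next
      case (step s1 s2)
      from step.IH obtain k y where s1: "s1 = st k y" and k: "computes f (k # map s rs) y"
        "\<forall>m < k. \<exists>z. computes f (m # map s rs) (Suc z)" by blast
      from step.hyps(2) obtain z where z: "y \<noteq> 0" "computes f (Suc k # map s rs) z" "s2 = st (Suc k) z"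
        unfolding s1 B by blast
      from z(1) k have "\<forall>m < Suc k. \<exists>z. computes f (m # map s rs) (Suc z)"
        by (metis less_Suc_eq not0_implies_Suc)
      with z show ?case by blast
    qed
    then obtain k y where k: "s' = st k y" "computes f (k # map s rs) y"
        "\<forall>m < k. \<exists>z. computes f (m # map s rs) (Suc z)" by blast
    from k(1) s' have y: "y = 0" by (simp add: st_def)
    have "s' = s(t := k)" using A k(1) y by (intro ext, auto simp: st_def)
    with k y show ?R by (auto simp: computes_Minim_iff)
  next
    assume ?R
    then obtain n where n: "computes f (n # map s rs) 0"
      "\<forall>m < n. \<exists>y. computes f (m # map s rs) (Suc y)" and s': "s' = s(t := n)"
      by (auto simp: computes_Minim_iff)
    from n obtain y0 where y0: "computes f (0 # map s rs) y0" by (cases n) auto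
    \<comment> \<open>Conversely, the loop reaches every candidate up to \<open>n\<close>, because
      all values below \<open>n\<close> are defined and nonzero.\<close>
    have "(exec ?B)\<^sup>*\<^sup>* (st 0 y0) (st k y)" if "k \<le> n" "computes f (k # map s rs) y" for k y
      using that
    proof (induction k arbitrary: y)
      case 0
      then show ?case using y0 computes_deterministic by blast
    next
      case (Suc k)
      from Suc.prems(1) n(2) obtain z where z: "computes f (k # map s rs) (Suc z)" by force
      have "(exec ?B)\<^sup>*\<^sup>* (st 0 y0) (st k (Suc z))" using Suc z by simp
      moreover have "exec ?B (st k (Suc z)) (st (Suc k) y)" unfolding B using Suc.prems(2) by blast
      ultimately show ?case by simp
    qed
    from this[of n 0] n have "(exec ?B)\<^sup>*\<^sup>* (st 0 y0) (st n 0)" by simp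
    moreover have "st n 0 = s'" using A s' by (intro ext, auto simp: st_def)
    ultimately show ?L unfolding E using y0 A s' by auto
  qed
qed

lemma correct: "correct f"
proof (induction f)
  case Zero
  then show ?case by (simp add: correct_def fun_upd_idem)
next
  case Succ
  have "exec (compile Succ rs t b) s s' \<longleftrightarrow> (\<exists>y. computes Succ (map s rs) y \<and> s' = s(t := y))"
    if A: "\<forall>r \<in> set rs. r < b" "t < b" "t \<notin> set rs" "\<forall>r \<ge> b. s r = 0" "s t = 0" for rs t b s s'
  proof (cases "length rs = 1")
    case True
    then obtain r where rs: "rs = [r]" by (auto simp: length_Suc_conv)
    then have "exec (copy r t b) s s1 \<longleftrightarrow> s1 = s(t := s r)" for s1
      using A by (intro exec_copy) auto
    then show ?thesis using rs A by (auto simp: exec_Seq computes_Succ_iff)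
  qed (auto simp: computes_Succ_iff)
  then show ?case unfolding correct_def by blast
next
  case (Proj i)
  have "exec (compile (Proj i) rs t b) s s' \<longleftrightarrow>
      (\<exists>y. computes (Proj i) (map s rs) y \<and> s' = s(t := y))"
    if A: "\<forall>r \<in> set rs. r < b" "t < b" "t \<notin> set rs" "\<forall>r \<ge> b. s r = 0" "s t = 0" for rs t b s s'
  proof (cases "i < length rs")
    case True
    then have "rs ! i \<in> set rs" by simp
    then have "exec (copy (rs ! i) t b) s s' \<longleftrightarrow> s' = s(t := s (rs ! i))"
      using A by (intro exec_copy) auto
    then show ?thesis using True by (auto simp: computes_Proj_iff)
  qed (auto simp: computes_Proj_iff)
  then show ?case unfolding correct_def by blast
qed (auto intro: correct_Comp correct_PrimRec correct_Minim)


section \<open>Sequences of actions and matchings\<close>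

lemma ex_run_snoc:
  "(\<exists>s'. run (as @ [a]) s s') \<longleftrightarrow> (\<exists>s1 s'. run as s s1 \<and> step a s1 s')"
  by (auto simp: run_append)

text \<open>Every action changes the counter and the two counts consistently; the form without
  subtraction keeps this an identity in the naturals.\<close>

lemma run_count:
  "run as s s' \<Longrightarrow> s' r + count_list as (Dec r) = s r + count_list as (Inc r)"
proof (induction as arbitrary: s)
  case (Cons a as)
  from Cons.prems obtain s1 where s1: "step a s s1" "run as s1 s'" by auto
  from Cons.IH[OF s1(2)] s1(1) show ?case by (cases a) (auto split: if_splits)
qed simp

definition balanced :: "act list \<Rightarrow> bool" where
  "balanced as \<longleftrightarrow> (\<forall>j < length as. \<forall>r.
     (as ! j = Dec r \<longrightarrow> count_list (take j as) (Dec r) < count_list (take j as) (Inc r)) \<and>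
     (as ! j = Test r \<longrightarrow> count_list (take j as) (Dec r) = count_list (take j as) (Inc r)))"

text \<open>By \<open>run_count\<close> the prefix alone fixes each counter, so whether the next
  action is enabled depends on two counts. Hence the induction appends actions at the end.\<close>

lemma runs_iff_balanced: "(\<exists>s'. run as (\<lambda>_. 0) s') \<longleftrightarrow> balanced as"
proof (induction as rule: rev_induct)
  case Nil
  then show ?case by (simp add: balanced_def)
next
  case (snoc a as)
  have count: "s1 r + count_list as (Dec r) = count_list as (Inc r)" if "run as (\<lambda>_. 0) s1" for s1 r
    using run_count[OF that] by simp
  have "(\<exists>s'. run (as @ [a]) (\<lambda>_. 0) s') \<longleftrightarrow> (\<exists>s1. run as (\<lambda>_. 0) s1 \<and> (\<exists>s'. step a s1 s'))"
    by (auto simp: ex_run_snoc)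
  also have "\<dots> \<longleftrightarrow> (\<exists>s1. run as (\<lambda>_. 0) s1 \<and> (\<forall>r.
      (a = Dec r \<longrightarrow> count_list as (Dec r) < count_list as (Inc r)) \<and>
      (a = Test r \<longrightarrow> count_list as (Dec r) = count_list as (Inc r))))"
  proof -
    have "(\<exists>s'. step a s1 s') \<longleftrightarrow> (\<forall>r.
      (a = Dec r \<longrightarrow> count_list as (Dec r) < count_list as (Inc r)) \<and>
      (a = Test r \<longrightarrow> count_list as (Dec r) = count_list as (Inc r)))"
      if "run as (\<lambda>_. 0) s1" for s1
      using count[OF that] by (cases a) (auto, (metis add_cancel_left_left less_add_same_cancel2 neq0_conv add.commute)+)
    then show ?thesis by blast
  qed
  also have "\<dots> \<longleftrightarrow> balanced (as @ [a])"
    using snoc by (auto simp: balanced_def nth_append less_Suc_eq)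
  finally show ?case .
qed

section \<open>Counts in prefixes of a sequence\<close>

lemma count_take_Suc:
  "j < length as \<Longrightarrow>
    count_list (take (Suc j) as) a = count_list (take j as) a + (if as ! j = a then 1 else 0)"
  by (simp add: take_Suc_conv_app_nth)

lemma count_take_card:
  "j \<le> length as \<Longrightarrow> count_list (take j as) a = card {i. i < j \<and> as ! i = a}"
proof (induction j)
  case (Suc j)
  have "{i. i < Suc j \<and> as ! i = a} =
      (if as ! j = a then insert j {i. i < j \<and> as ! i = a} else {i. i < j \<and> as ! i = a})"
    by (auto simp: less_Suc_eq)
  with Suc show ?case by (simp add: count_take_Suc)
qed simp

lemma count_take_mono: "i \<le> j \<Longrightarrow> count_list (take i as) a \<le> count_list (take j as) a"
  by (metis count_list_append le_Suc_ex le_add1 take_add)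

lemma count_take_strict:
  assumes "i < j" "i < length as" "as ! i = a"
  shows "count_list (take i as) a < count_list (take j as) a"
  using count_take_Suc[of i as a] count_take_mono[of "Suc i" j as a] assms by simp

text \<open>A discrete intermediate value argument: the count grows by at most one per position, so
  each value below the final one is taken just before an occurrence of \<open>a\<close>.\<close>

lemma count_take_reach:
  "j \<le> length as \<Longrightarrow> k < count_list (take j as) a \<Longrightarrow>
    \<exists>i < j. as ! i = a \<and> count_list (take i as) a = k"
proof (induction j)
  case (Suc j)
  show ?case
  proof (cases "k < count_list (take j as) a")
    case True
    with Suc show ?thesis by (auto intro: less_SucI)
  next
    case False
    with Suc.prems show ?thesis
      by (intro exI[of _ j]) (auto simp: count_take_Suc split: if_splits)
  qed
qed simp


section \<open>Data words of balanced sequences\<close>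

text \<open>Residues modulo 3 separate the three kinds of action. The simp rules are removed below
  so that letters are compared through injectivity.\<close>

fun act_code :: "act \<Rightarrow> nat" where
  "act_code (Inc r) = 3 * r"
| "act_code (Dec r) = 3 * r + 1"
| "act_code (Test r) = 3 * r + 2"

lemma act_code_eq_iff [simp]: "act_code a = act_code b \<longleftrightarrow> a = b"
  by (cases a; cases b) (simp_all, presburger+)

declare act_code.simps [simp del]

fun reg :: "act \<Rightarrow> nat" where
  "reg (Inc r) = r"
| "reg (Dec r) = r"
| "reg (Test r) = r"

text \<open>
  The last condition says that no class links an \<open>Inc\<close> before a \<open>Test\<close> to a \<open>Dec\<close> after it.
\<close>

definition good_at :: "(nat, 'd) data_word \<Rightarrow> nat \<Rightarrow> nat \<Rightarrow> bool" where
  "good_at w r p \<longleftrightarrow>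
    (letter_at w p = act_code (Dec r) \<longrightarrow>
      (\<exists>i. is_class_pred w p i \<and> letter_at w i = act_code (Inc r))) \<and>
    (letter_at w p = act_code (Test r) \<longrightarrow>
      (\<forall>i \<in> positions w. i \<le> p \<longrightarrow> letter_at w i = act_code (Inc r) \<longrightarrow>
        (\<exists>j. is_class_succ w i j \<and> letter_at w j = act_code (Dec r))) \<and>
      (\<forall>q \<in> positions w. p < q \<longrightarrow> letter_at w q = act_code (Dec r) \<longrightarrow>
        (\<exists>i. is_class_pred w q i \<and> p < i)))"

definition good :: "(nat, 'd) data_word \<Rightarrow> nat \<Rightarrow> bool" where
  "good w r \<longleftrightarrow> (\<forall>p \<in> positions w. good_at w r p)"

text \<open>The indices may run beyond the word, where \<open>letter_at\<close> has no meaning, so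
  users secure the positions separately.\<close>

fun spells :: "(nat, 'd) data_word \<Rightarrow> nat \<Rightarrow> act list \<Rightarrow> bool" where
  "spells w i [] \<longleftrightarrow> True"
| "spells w i (a # as) \<longleftrightarrow> letter_at w i = act_code a \<and> spells w (Suc i) as"

lemma spells_append: "spells w i (as @ bs) \<longleftrightarrow> spells w i as \<and> spells w (i + length as) bs"
  by (induction as arbitrary: i) auto

lemma spells_nth: "spells w i as \<longleftrightarrow> (\<forall>j < length as. letter_at w (i + j) = act_code (as ! j))"
  by (induction as arbitrary: i) (auto simp: less_Suc_eq_0_disj)

lemma is_class_succ_iff_pred: "is_class_succ w i j \<longleftrightarrow> is_class_pred w j i"
  unfolding is_class_succ_def is_class_pred_def same_class_def by metis

lemma class_pred_unique: "is_class_pred w i j \<Longrightarrow> is_class_pred w i k \<Longrightarrow> j = k"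
  unfolding is_class_pred_def by (metis linorder_neqE_nat)

lemma class_succ_unique: "is_class_succ w i j \<Longrightarrow> is_class_succ w i k \<Longrightarrow> j = k"
  unfolding is_class_succ_def by (metis linorder_neqE_nat)

text \<open>Class predecessors map decrements injectively to earlier increments, which bounds the
  counts from one side. Before a test every increment has a decrement as class successor, and these
  links do not cross the test; this gives the reverse bound.\<close>

lemma good_imp_balanced:
  assumes good: "\<And>r. r \<in> reg ` set as \<Longrightarrow> good w r"
    and spells: "spells w 1 as" and len: "length as \<le> length w"
  shows "balanced as"
  unfolding balanced_def
proof (intro allI impI)
  fix j r assume j: "j < length as"
  have letter: "letter_at w (Suc i) = act_code (as ! i)" if "i < length as" for i
    using spells that by (simp add: spells_nth)
  have pos: "Suc i \<in> positions w" if "i < length as" for i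
    using that len by (simp add: positions_def)
  have dec: "\<exists>k < i. as ! k = Inc r \<and> is_class_pred w (Suc i) (Suc k)"
    if r: "good w r" and i: "i < length as" "as ! i = Dec r" for i
  proof -
    have "good_at w r (Suc i)" using r pos i by (auto simp: good_def)
    then obtain p where p: "is_class_pred w (Suc i) p" "letter_at w p = act_code (Inc r)"
      using letter[OF i(1)] i(2) by (auto simp: good_at_def)
    from p(1) have "0 < p" "p < Suc i" by (auto simp: is_class_pred_def positions_def)
    then obtain k where k: "p = Suc k" "k < i" by (cases p) auto
    with p letter[of k] i(1) have "as ! k = Inc r" by (simp flip: act_code_eq_iff)
    with k p show ?thesis by blast
  qed
  \<comment> \<open>Used with \<open>m = n\<close> for equal prefixes, and with
    \<open>m = Suc n\<close> to include a decrement at \<open>n\<close> itself, whose partner lies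
    before \<open>n\<close>; the latter yields the strict inequality.\<close>
  have count: "count_list (take m as) (Dec r) \<le> card {i. i < n \<and> as ! i = Inc r}"
    if r: "good w r" and m: "m \<le> length as" "m \<le> Suc n" for m n
    unfolding count_take_card[OF m(1)]
  proof (rule card_le_if_inj_on_rel[where r = "\<lambda>i k. is_class_pred w (Suc i) (Suc k)"])
    show "\<exists>k. k \<in> {i. i < n \<and> as ! i = Inc r} \<and> is_class_pred w (Suc i) (Suc k)"
      if "i \<in> {i. i < m \<and> as ! i = Dec r}" for i
    proof -
      from that m have i: "i < length as" "as ! i = Dec r" "i \<le> n" by auto
      from dec[OF r i(1,2)] i(3) show ?thesis by (auto intro: less_le_trans)
    qed
    show "i = i'" if "is_class_pred w (Suc i) (Suc k)" "is_class_pred w (Suc i') (Suc k)" for i i' k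
      using that class_succ_unique[of w "Suc k"] unfolding is_class_succ_iff_pred by blast
  qed simp
  have "count_list (take j as) (Dec r) < count_list (take j as) (Inc r)" if a: "as ! j = Dec r"
  proof -
    have "good w r" using good j a by (metis image_eqI nth_mem reg.simps(2))
    from count[OF this, of "Suc j" j] j a show ?thesis
      by (simp add: count_take_Suc count_take_card[of j as "Inc r"])
  qed
  moreover have "count_list (take j as) (Dec r) = count_list (take j as) (Inc r)"
    if a: "as ! j = Test r"
  proof (rule antisym)
    have r: "good w r" using good j a by (metis image_eqI nth_mem reg.simps(3))
    show "count_list (take j as) (Dec r) \<le> count_list (take j as) (Inc r)"
      using count[OF r, of j j] j by (simp add: count_take_card[of j as "Inc r"])
    have test: "good_at w r (Suc j)" "letter_at w (Suc j) = act_code (Test r)"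
      using r pos[OF j] letter[OF j] a by (auto simp: good_def)
    have "\<exists>k < j. as ! k = Dec r \<and> is_class_pred w (Suc k) (Suc i)"
      if i: "i < j" "as ! i = Inc r" for i
    proof -
      have "\<exists>p. is_class_succ w (Suc i) p \<and> letter_at w p = act_code (Dec r)"
        using test i j letter[of i] pos[of i] by (auto simp: good_at_def)
      then obtain p where p: "is_class_pred w p (Suc i)" "letter_at w p = act_code (Dec r)"
        unfolding is_class_succ_iff_pred by blast
      \<comment> \<open>A decrement after the test has its class predecessor after the test, but
        that of \<open>p\<close> is \<open>Suc i\<close>, which lies before it.\<close>
      have "\<not> Suc j < p"
      proof
        assume "Suc j < p"
        moreover have "p \<in> positions w" using p(1) by (simp add: is_class_pred_def)
        ultimately obtain q where "is_class_pred w p q" "Suc j < q"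
          using test p(2) by (auto simp: good_at_def)
        with class_pred_unique[OF p(1), of q] i(1) show False by simp
      qed
      moreover have "p \<noteq> Suc j" using p(2) test(2) by auto
      moreover have "0 < p" using p(1) by (auto simp: is_class_pred_def positions_def)
      ultimately obtain k where k: "p = Suc k" "k < j" by (cases p) auto
      with p(2) letter[of k] j have "as ! k = Dec r" by (simp flip: act_code_eq_iff)
      with k p(1) show ?thesis by blast
    qed
    then show "count_list (take j as) (Inc r) \<le> count_list (take j as) (Dec r)"
      unfolding count_take_card[OF less_imp_le[OF j]]
      by (intro card_le_if_inj_on_rel[where r = "\<lambda>i k. is_class_pred w (Suc k) (Suc i)"])
        (auto dest: class_pred_unique)
  qed
  ultimately show "(as ! j = Dec r \<longrightarrow>
      count_list (take j as) (Dec r) < count_list (take j as) (Inc r)) \<and>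
    (as ! j = Test r \<longrightarrow>
      count_list (take j as) (Dec r) = count_list (take j as) (Inc r))"
    by blast
qed

text \<open>The \<open>k\<close>-th \<open>Inc r\<close> and the \<open>k\<close>-th \<open>Dec r\<close> form a class.\<close>

definition key :: "act list \<Rightarrow> nat \<Rightarrow> nat \<times> nat" where
  "key as i = (case as ! i of
      Inc r \<Rightarrow> (Suc r, count_list (take i as) (Inc r))
    | Dec r \<Rightarrow> (Suc r, count_list (take i as) (Dec r))
    | Test r \<Rightarrow> (0, 0))"

definition word_of :: "(nat \<Rightarrow> 'd) \<Rightarrow> act list \<Rightarrow> (nat, 'd) data_word" where
  "word_of \<delta> as = map (\<lambda>i. (act_code (as ! i), \<delta> (prod_encode (key as i)))) [0..<length as]"

lemma length_word_of [simp]: "length (word_of \<delta> as) = length as"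
  by (simp add: word_of_def)

lemma letter_word_of [simp]: "i < length as \<Longrightarrow> letter_at (word_of \<delta> as) (Suc i) = act_code (as ! i)"
  by (simp add: word_of_def letter_at_def)

lemma spells_word_of: "spells (word_of \<delta> as) 1 as"
  by (simp add: spells_nth)

lemma word_of_in_lists:
  "range \<delta> \<subseteq> D \<Longrightarrow> word_of \<delta> as \<in> lists (act_code ` set as \<times> D)"
  by (auto simp: word_of_def image_subset_iff)

lemma same_class_word_of:
  assumes "inj \<delta>" "i < length as" "j < length as"
  shows "same_class (word_of \<delta> as) (Suc i) (Suc j) \<longleftrightarrow> key as i = key as j"
  using assms by (simp add: same_class_def datum_at_def word_of_def inj_eq)

lemma positions_word_of: "p \<in> positions (word_of \<delta> as) \<longleftrightarrow> (\<exists>i < length as. p = Suc i)"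
  by (cases p) (auto simp: positions_def)

text \<open>Balance places the decrement after its increment. No action between the two shares their
  key: later increments have a larger index, earlier decrements a smaller one.\<close>

lemma class_pred_word_of:
  assumes \<delta>: "inj \<delta>" and bal: "balanced as"
    and i: "i < length as" "as ! i = Inc r" and j: "j < length as" "as ! j = Dec r"
    and eq: "count_list (take i as) (Inc r) = count_list (take j as) (Dec r)"
  shows "is_class_pred (word_of \<delta> as) (Suc j) (Suc i)"
proof -
  have "count_list (take i as) (Inc r) < count_list (take j as) (Inc r)"
    using bal j eq by (auto simp: balanced_def)
  then have ij: "i < j" using count_take_mono[of j i as "Inc r"] by (meson leD not_less)
  have key: "key as i = key as j" using i j eq by (simp add: key_def)
  have "\<not> same_class (word_of \<delta> as) (Suc j) k" if k: "Suc i < k" "k < Suc j" for k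
  proof
    assume same: "same_class (word_of \<delta> as) (Suc j) k"
    obtain m where m: "k = Suc m" "i < m" "m < j" using k by (cases k) auto
    then have "key as m = key as j" using same \<delta> j by (simp add: same_class_word_of)
    then consider "as ! m = Inc r" "count_list (take m as) (Inc r) = count_list (take i as) (Inc r)"
      | "as ! m = Dec r" "count_list (take m as) (Dec r) = count_list (take j as) (Dec r)"
      using j eq by (auto simp: key_def split: act.splits)
    then show False
    proof cases
      case 1
      with count_take_strict[OF m(2) i] show False by simp
    next
      case 2
      with count_take_strict[OF m(3) _ 2(1)] m j show False by simp
    qed
  qed
  then show ?thesis using \<delta> i j ij key
    by (auto simp: is_class_pred_def positions_word_of same_class_word_of)
qed

text \<open>At a test the counts of increments and decrements agree, so partners of equal index lie
  on the same side of it.\<close>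

lemma good_word_of:
  assumes \<delta>: "inj \<delta>" and bal: "balanced as"
  shows "good (word_of \<delta> as) r"
proof -
  let ?w = "word_of \<delta> as"
  have dec: "\<exists>i < j. as ! i = Inc r \<and> is_class_pred ?w (Suc j) (Suc i) \<and>
      count_list (take i as) (Inc r) = count_list (take j as) (Dec r)"
    if j: "j < length as" "as ! j = Dec r" for j
  proof -
    have "count_list (take j as) (Dec r) < count_list (take j as) (Inc r)"
      using bal j by (auto simp: balanced_def)
    then obtain i where "i < j" "as ! i = Inc r"
      "count_list (take i as) (Inc r) = count_list (take j as) (Dec r)"
      using count_take_reach[of j as] j by force
    with class_pred_word_of[OF \<delta> bal _ _ j] j show ?thesis by force
  qed
  have "good_at ?w r (Suc p)" if p: "p < length as" for p
    unfolding good_at_def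
  proof (intro conjI impI ballI)
    assume "letter_at ?w (Suc p) = act_code (Dec r)"
    then have "as ! p = Dec r" using p by simp
    from dec[OF p this] p show "\<exists>i. is_class_pred ?w (Suc p) i \<and> letter_at ?w i = act_code (Inc r)"
      by force
  next
    fix i assume test: "letter_at ?w (Suc p) = act_code (Test r)"
      and i: "i \<in> positions ?w" "i \<le> Suc p" "letter_at ?w i = act_code (Inc r)"
    from i(1) obtain k where k: "i = Suc k" "k < length as" by (auto simp: positions_word_of)
    with i have a: "as ! k = Inc r" by simp
    have t: "as ! p = Test r" using test p by simp
    then have "count_list (take p as) (Dec r) = count_list (take p as) (Inc r)"
      using bal p by (auto simp: balanced_def)
    moreover have "k < p" using i(2) k a t by (cases "k = p") auto
    ultimately have "count_list (take k as) (Inc r) < count_list (take p as) (Dec r)"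
      using count_take_strict[OF _ k(2) a] by simp
    then obtain j where j: "j < p" "as ! j = Dec r"
      "count_list (take j as) (Dec r) = count_list (take k as) (Inc r)"
      using count_take_reach[of p as] p by force
    then have "is_class_succ ?w i (Suc j)"
      unfolding is_class_succ_iff_pred k(1) using p k a
      by (intro class_pred_word_of[OF \<delta> bal, where r = r]) auto
    with j p show "\<exists>j. is_class_succ ?w i j \<and> letter_at ?w j = act_code (Dec r)"
      by (intro exI[of _ "Suc j"]) simp
  next
    fix q assume test: "letter_at ?w (Suc p) = act_code (Test r)"
      and q: "q \<in> positions ?w" "Suc p < q" "letter_at ?w q = act_code (Dec r)"
    from q(1) obtain j where j: "q = Suc j" "j < length as" by (auto simp: positions_word_of)
    with q have "as ! j = Dec r" by simp
    from dec[OF j(2) this] obtain i where i: "i < j" "as ! i = Inc r"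
      "is_class_pred ?w (Suc j) (Suc i)"
      "count_list (take i as) (Inc r) = count_list (take j as) (Dec r)" by blast
    have t: "as ! p = Test r" using test p by simp
    then have "count_list (take p as) (Inc r) = count_list (take p as) (Dec r)"
      using bal p by (auto simp: balanced_def)
    also have "\<dots> \<le> count_list (take i as) (Inc r)"
      unfolding i(4) using q(2) j by (intro count_take_mono) simp
    \<comment> \<open>Were \<open>i\<close> before the test, its index would be below the number of
      increments before the test, contrary to the chain just established.\<close>
    finally have "\<not> i < p" using count_take_strict[of i p as, OF _ _ i(2)] p by fastforce
    moreover have "i \<noteq> p" using i(2) t by auto
    ultimately show "\<exists>i. is_class_pred ?w q i \<and> Suc p < i" using i(3) j by (intro exI[of _ "Suc i"]) simp
  qed
  then show ?thesis by (auto simp: good_def positions_word_of)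
qed


section \<open>From programs to formulas\<close>

lemma sem_cong:
  "(\<And>x. x \<in> free_vars \<phi> \<Longrightarrow> v x = v' x) \<Longrightarrow> sem w v \<phi> = sem w v' \<phi>"
proof (induction \<phi> arbitrary: v v')
  case (Mu x \<phi>)
  have "sem w (v(x := S)) \<phi> = sem w (v'(x := S)) \<phi>" for S
  proof (rule Mu.IH)
    fix y assume "y \<in> free_vars \<phi>"
    then show "(v(x := S)) y = (v'(x := S)) y" using Mu.prems[of y] by (cases "y = x") simp_all
  qed
  then show ?case by (simp only: sem.simps)
next
  case (Nu x \<phi>)
  have "sem w (v(x := S)) \<phi> = sem w (v'(x := S)) \<phi>" for S
  proof (rule Nu.IH)
    fix y assume "y \<in> free_vars \<phi>"
    then show "(v(x := S)) y = (v'(x := S)) y" using Nu.prems[of y] by (cases "y = x") simp_all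
  qed
  then show ?case by (simp only: sem.simps)
next
  case (Modal M \<phi>)
  have "sem w v \<phi> = sem w v' \<phi>" by (rule Modal.IH, rule Modal.prems) simp
  then show ?case by (simp only: sem.simps)
next
  case (Or \<phi> \<psi>)
  have "sem w v \<phi> = sem w v' \<phi>" by (rule Or.IH(1), rule Or.prems) simp
  moreover have "sem w v \<psi> = sem w v' \<psi>" by (rule Or.IH(2), rule Or.prems) simp
  ultimately show ?case by (simp only: sem.simps)
next
  case (And \<phi> \<psi>)
  have "sem w v \<phi> = sem w v' \<phi>" by (rule And.IH(1), rule And.prems) simp
  moreover have "sem w v \<psi> = sem w v' \<psi>" by (rule And.IH(2), rule And.prems) simp
  ultimately show ?case by (simp only: sem.simps)
qed simp_all

lemma sem_upd_fresh: "x \<notin> free_vars \<phi> \<Longrightarrow> sem w (v(x := S)) \<phi> = sem w v \<phi>"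
  by (rule sem_cong) auto

lemma sem_Mu_unfold: "sem w v (Mu x \<phi>) = sem w (v(x := sem w v (Mu x \<phi>))) \<phi>"
  unfolding sem.simps by (rule lfp_unfold[OF mono_sem_upd])

lemma sem_Mu_least: "sem w (v(x := S)) \<phi> \<subseteq> S \<Longrightarrow> sem w v (Mu x \<phi>) \<subseteq> S"
  unfolding sem.simps by (rule lfp_lowerbound)

fun tr :: "nat \<Rightarrow> prog \<Rightarrow> nat fml \<Rightarrow> nat fml" where
  "tr n Skip K = K"
| "tr n (Act a) K = And (Atom (Letter (act_code a))) (Modal XG K)"
| "tr n (Seq p q) K = tr n p (tr n q K)"
| "tr n (Star p) K = Mu n (Or K (tr (Suc n) p (Var n)))"

lemma free_vars_tr: "free_vars (tr n p K) \<subseteq> free_vars K"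
proof (induction p arbitrary: n K)
  case (Star p)
  from Star[of "Suc n" "Var n"] show ?case by auto
qed (simp_all, blast)

lemma mu_fragment_tr: "mu_fragment K \<Longrightarrow> mu_fragment (tr n p K)"
  by (induction p arbitrary: n K) auto

text \<open>Bounds the actions of all sequences in the language, hence the finitely many registers
  whose matching has to be demanded.\<close>

fun acts :: "prog \<Rightarrow> act list" where
  "acts Skip = []"
| "acts (Act a) = [a]"
| "acts (Seq p q) = acts p @ acts q"
| "acts (Star p) = acts p"

lemma lang_acts: "as \<in> lang p \<Longrightarrow> set as \<subseteq> set (acts p)"
proof (induction p arbitrary: as)
  case (Seq p q)
  then show ?case by fastforce
next
  case (Star p)
  from Star.prems obtain ass where ass: "as = concat ass" "set ass \<subseteq> lang p" by auto
  then have "\<forall>bs \<in> set ass. set bs \<subseteq> set (acts p)" using Star.IH by blast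
  then show ?case unfolding ass(1) by auto
qed auto

lemma act_code_in_tr: "act_code ` set (acts p) \<subseteq> set_fml (tr n p K)"
  and set_fml_tr_cont: "set_fml K \<subseteq> set_fml (tr n p K)"
proof -
  have "act_code ` set (acts p) \<subseteq> set_fml (tr n p K) \<and> set_fml K \<subseteq> set_fml (tr n p K)"
  proof (induction p arbitrary: n K)
    case (Seq p q)
    show ?case using Seq.IH(1)[of n "tr n q K"] Seq.IH(2)[of n K] by auto
  qed auto
  then show "act_code ` set (acts p) \<subseteq> set_fml (tr n p K)" "set_fml K \<subseteq> set_fml (tr n p K)"
    by blast+
qed

lemma sem_imp_position: "i \<in> sem w v \<phi> \<Longrightarrow> i \<in> positions w"
  using sem_subset_positions by blast

text \<open>A least fixpoint admits only finitely many unfoldings, which are the rounds of the star.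
  The bound on the free variables keeps the meaning of \<open>K\<close> independent of the variable
  that the star binds.\<close>

lemma sem_tr:
  assumes "free_vars K \<subseteq> {..<n}"
  shows "sem w v (tr n p K) =
    {i \<in> positions w. \<exists>as \<in> lang p. spells w i as \<and> i + length as \<in> sem w v K}"
  using assms
proof (induction p arbitrary: n K v)
  case Skip
  then show ?case using sem_imp_position[of _ w v K] by auto
next
  case (Act a)
  then show ?case using sem_imp_position[of _ w v K] by auto
next
  case (Seq p q)
  have "free_vars (tr n q K) \<subseteq> {..<n}" using free_vars_tr[of n q K] Seq.prems by blast
  note IH = Seq.IH(1)[OF this, of v] Seq.IH(2)[OF Seq.prems, of v]
  show ?case
  proof (intro set_eqI iffI)
    fix i assume "i \<in> sem w v (tr n (Seq p q) K)"
    then obtain as bs where *: "i \<in> positions w" "as \<in> lang p" "bs \<in> lang q" "spells w i as"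
      "spells w (i + length as) bs" "i + length as + length bs \<in> sem w v K"
      by (auto simp: IH)
    then have "as @ bs \<in> lang (Seq p q)" by auto
    moreover have "spells w i (as @ bs)" "i + length (as @ bs) \<in> sem w v K"
      using * by (simp_all add: spells_append add.assoc)
    ultimately show
      "i \<in> {i \<in> positions w. \<exists>as \<in> lang (Seq p q). spells w i as \<and> i + length as \<in> sem w v K}"
      using *(1) by blast
  next
    fix i assume "i \<in> {i \<in> positions w. \<exists>as \<in> lang (Seq p q). spells w i as \<and> i + length as \<in> sem w v K}"
    then obtain as bs where *: "i \<in> positions w" "as \<in> lang p" "bs \<in> lang q" "spells w i as"
      "spells w (i + length as) bs" "i + length as + length bs \<in> sem w v K"
      by (auto simp: spells_append add.assoc)
    then have "i + length as \<in> positions w"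
      using sem_imp_position[OF *(6)] by (simp add: positions_def)
    with * show "i \<in> sem w v (tr n (Seq p q) K)" by (auto simp: IH)
  qed
next
  case (Star p)
  let ?M = "Mu n (Or K (tr (Suc n) p (Var n)))"
  let ?X = "{i \<in> positions w. \<exists>as \<in> lang (Star p). spells w i as \<and> i + length as \<in> sem w v K}"
  have K: "sem w (v(n := S)) K = sem w v K" for S
    using Star.prems by (intro sem_upd_fresh) auto
  have p: "sem w (v(n := S)) (tr (Suc n) p (Var n)) =
      {i \<in> positions w. \<exists>as \<in> lang p. spells w i as \<and> i + length as \<in> S \<inter> positions w}" for S
    by (subst Star.IH) auto
  have body: "sem w (v(n := S)) (Or K (tr (Suc n) p (Var n))) = sem w v K \<union>
      {i \<in> positions w. \<exists>as \<in> lang p. spells w i as \<and> i + length as \<in> S \<inter> positions w}" for S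
    unfolding sem.simps K p ..
  \<comment> \<open>\<open>?X\<close> is closed under the body: no round at all, or one round
    followed by a list of rounds.\<close>
  have "sem w v ?M \<subseteq> ?X"
  proof (rule sem_Mu_least, unfold body, intro Un_least subsetI)
    fix i assume i: "i \<in> sem w v K"
    have "[] \<in> lang (Star p)" unfolding lang.simps by (rule image_eqI[of _ _ "[]"]) simp_all
    moreover have "spells w i []" "i + length [] \<in> sem w v K" using i by simp_all
    ultimately show "i \<in> ?X" using sem_imp_position[OF i] by blast
  next
    fix i assume "i \<in> {i \<in> positions w. \<exists>as \<in> lang p. spells w i as \<and> i + length as \<in> ?X \<inter> positions w}"
    then obtain as ass where as: "i \<in> positions w" "as \<in> lang p" "spells w i as"
      "set ass \<subseteq> lang p" "spells w (i + length as) (concat ass)"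
      "i + length as + length (concat ass) \<in> sem w v K"
      by auto
    have "concat (as # ass) \<in> lang (Star p)" unfolding lang.simps
      by (rule imageI) (use as in auto)
    moreover have "spells w i (concat (as # ass))" "i + length (concat (as # ass)) \<in> sem w v K"
      using as by (simp_all add: spells_append add.assoc)
    ultimately show "i \<in> ?X" using as(1) by blast
  qed
  moreover have "?X \<subseteq> sem w v ?M"
  proof
    have "i \<in> sem w v ?M" if "i \<in> positions w" "set ass \<subseteq> lang p" "spells w i (concat ass)"
      "i + length (concat ass) \<in> sem w v K" for ass i
      using that
    proof (induction ass arbitrary: i)
      case Nil
      then show ?case by (subst sem_Mu_unfold, unfold body) simp
    next
      case (Cons as ass)
      have "i + length as \<in> positions w"
        using sem_imp_position[OF Cons.prems(4)] Cons.prems(1) by (simp add: positions_def)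
      moreover from this have "i + length as \<in> sem w v ?M"
        using Cons.prems by (intro Cons.IH) (simp_all add: spells_append add.assoc)
      ultimately show ?case
        using Cons.prems by (subst sem_Mu_unfold, unfold body) (auto simp: spells_append)
    qed
    then show "i \<in> sem w v ?M" if "i \<in> ?X" for i
      using that by auto
  qed
  ultimately show ?case unfolding tr.simps by (rule antisym)
qed

text \<open>A word is finite, so the walk to the right ends at the last position and a least
  fixpoint does the work of a greatest one. The end gets its own disjunct since \<open>XG\<close>
  demands a successor.\<close>

definition always :: "nat \<Rightarrow> 'a fml \<Rightarrow> 'a fml" where
  "always x \<phi> = Mu x (And (Or (Atom LastG) (Modal XG (Var x))) \<phi>)"

definition so_far :: "nat \<Rightarrow> 'a fml \<Rightarrow> 'a fml" where
  "so_far x \<phi> = Mu x (And (Or (Atom FirstG) (Modal YG (Var x))) \<phi>)"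

lemma sem_always:
  assumes "x \<notin> free_vars \<phi>"
  shows "sem w v (always x \<phi>) = {i \<in> positions w. \<forall>j \<in> positions w. i \<le> j \<longrightarrow> j \<in> sem w v \<phi>}"
    (is "_ = ?X")
proof -
  have body: "sem w (v(x := S)) (And (Or (Atom LastG) (Modal XG (Var x))) \<phi>) =
      {i \<in> positions w. (i = length w \<or> Suc i \<in> positions w \<and> Suc i \<in> S) \<and> i \<in> sem w v \<phi>}" for S
    using sem_upd_fresh[OF assms, of w v S] sem_imp_position[of _ w v \<phi>] by auto
  have "sem w v (always x \<phi>) \<subseteq> ?X"
    unfolding always_def
  proof (rule sem_Mu_least, unfold body, clarify)
    fix i j assume "i = length w \<or> Suc i \<in> positions w \<and> Suc i \<in> ?X" "i \<in> sem w v \<phi>"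
      "j \<in> positions w" "i \<le> j"
    then show "j \<in> sem w v \<phi>" by (cases "i = j") (auto simp: positions_def)
  qed
  moreover have "i \<in> sem w v (always x \<phi>)" if "i \<in> ?X" for i
    using that unfolding always_def
  proof (induction "length w - i" arbitrary: i rule: less_induct)
    case less
    have "Suc i \<in> sem w v (Mu x (And (Or (Atom LastG) (Modal XG (Var x))) \<phi>))" if "i \<noteq> length w"
      using less.prems that by (intro less.hyps) (auto simp: positions_def)
    then show ?case using less.prems
      by (subst sem_Mu_unfold, unfold body) (auto simp: positions_def)
  qed
  ultimately show ?thesis by blast
qed

lemma sem_so_far:
  assumes "x \<notin> free_vars \<phi>"
  shows "sem w v (so_far x \<phi>) = {i \<in> positions w. \<forall>j \<in> positions w. j \<le> i \<longrightarrow> j \<in> sem w v \<phi>}"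
    (is "_ = ?X")
proof -
  have body: "sem w (v(x := S)) (And (Or (Atom FirstG) (Modal YG (Var x))) \<phi>) =
      {i \<in> positions w. (i = 1 \<or> i - 1 \<in> positions w \<and> i - 1 \<in> S) \<and> i \<in> sem w v \<phi>}" for S
    using sem_upd_fresh[OF assms, of w v S] sem_imp_position[of _ w v \<phi>]
    by (auto simp: positions_def)
  have "sem w v (so_far x \<phi>) \<subseteq> ?X"
    unfolding so_far_def
  proof (rule sem_Mu_least, unfold body, clarify)
    fix i j assume "i = 1 \<or> i - 1 \<in> positions w \<and> i - 1 \<in> ?X" "i \<in> sem w v \<phi>"
      "j \<in> positions w" "j \<le> i"
    then show "j \<in> sem w v \<phi>" by (cases "i = j") (auto simp: positions_def)
  qed
  moreover have "i \<in> sem w v (so_far x \<phi>)" if "i \<in> ?X" for i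
    using that unfolding so_far_def
  proof (induction i)
    case 0
    then show ?case by (simp add: positions_def)
  next
    case (Suc i)
    have "i \<in> sem w v (Mu x (And (Or (Atom FirstG) (Modal YG (Var x))) \<phi>))" if "Suc i \<noteq> 1"
      using Suc.prems that by (intro Suc.IH) (auto simp: positions_def)
    then show ?case using Suc.prems
      by (subst sem_Mu_unfold, unfold body) (auto simp: positions_def)
  qed
  ultimately show ?thesis by blast
qed

section \<open>Well-matched words as a fixpoint formula\<close>

definition inc_matched :: "nat \<Rightarrow> nat fml" where
  "inc_matched r = Or (NegAtom (Letter (act_code (Inc r)))) (Modal XC (Atom (Letter (act_code (Dec r)))))"

definition dec_matched :: "nat \<Rightarrow> nat fml" where
  "dec_matched r = Or (NegAtom (Letter (act_code (Dec r)))) (Modal YC (Atom (Letter (act_code (Inc r)))))"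

definition dec_in :: "nat \<Rightarrow> nat \<Rightarrow> nat fml" where
  "dec_in r x = Or (NegAtom (Letter (act_code (Dec r)))) (Modal YC (Var x))"

text \<open>
  Were some \<open>Dec\<close> after a \<open>Test\<close> linked to a position before that \<open>Test\<close>, unfolding the fixpoint
  would lead back to that \<open>Test\<close>; being least, the fixpoint excludes this.
\<close>

definition matching :: "nat \<Rightarrow> nat fml" where
  "matching r = Mu 0 (And (Or (Atom LastG) (Modal XG (Var 0)))
    (And (dec_matched r)
      (Or (NegAtom (Letter (act_code (Test r))))
        (And (so_far 1 (inc_matched r))
          (Or (Atom LastG) (Modal XG (always 1 (dec_in r 0))))))))"

lemma sem_inc_matched:
  "sem w v (inc_matched r) = {i \<in> positions w. letter_at w i = act_code (Inc r) \<longrightarrow>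
    (\<exists>j. is_class_succ w i j \<and> letter_at w j = act_code (Dec r))}"
  unfolding inc_matched_def by (auto simp: is_class_succ_def)

lemma sem_dec_matched:
  "sem w v (dec_matched r) = {i \<in> positions w. letter_at w i = act_code (Dec r) \<longrightarrow>
    (\<exists>j. is_class_pred w i j \<and> letter_at w j = act_code (Inc r))}"
  unfolding dec_matched_def by (auto simp: is_class_pred_def)

lemma sem_dec_in:
  "sem w v (dec_in r x) = {i \<in> positions w. letter_at w i = act_code (Dec r) \<longrightarrow>
    (\<exists>j. is_class_pred w i j \<and> j \<in> v x)}"
  unfolding dec_in_def by (auto simp: is_class_pred_def)

text \<open>Positions enter the fixpoint from the right end leftwards, a test after everything to
  its right. Requiring that a class predecessor is already in thus amounts to requiring that it lies
  after the test.\<close>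

lemma sem_matching: "1 \<in> sem w v (matching r) \<longleftrightarrow> w \<noteq> [] \<and> good w r"
proof -
  let ?body = "And (Or (Atom LastG) (Modal XG (Var 0)))
    (And (dec_matched r)
      (Or (NegAtom (Letter (act_code (Test r))))
        (And (so_far 1 (inc_matched r))
          (Or (Atom LastG) (Modal XG (always 1 (dec_in r 0)))))))"
  \<comment> \<open>This is \<open>good_at\<close> with the order condition \<open>p < i\<close>
    replaced by membership in \<open>S\<close>.\<close>
  define cond where "cond S p \<longleftrightarrow>
    (letter_at w p = act_code (Dec r) \<longrightarrow>
      (\<exists>i. is_class_pred w p i \<and> letter_at w i = act_code (Inc r))) \<and>
    (letter_at w p = act_code (Test r) \<longrightarrow>
      (\<forall>i \<in> positions w. i \<le> p \<longrightarrow> letter_at w i = act_code (Inc r) \<longrightarrow>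
        (\<exists>j. is_class_succ w i j \<and> letter_at w j = act_code (Dec r))) \<and>
      (\<forall>q \<in> positions w. p < q \<longrightarrow> letter_at w q = act_code (Dec r) \<longrightarrow>
        (\<exists>i. is_class_pred w q i \<and> i \<in> S)))" for S p
  have fresh: "1 \<notin> free_vars (inc_matched r)" "1 \<notin> free_vars (dec_in r 0)"
    by (simp_all add: inc_matched_def dec_in_def)
  have body: "p \<in> sem w (v(0 := S)) ?body \<longleftrightarrow>
      p \<in> positions w \<and> (p = length w \<or> Suc p \<in> positions w \<and> Suc p \<in> S) \<and> cond S p" for S p
    unfolding sem.simps sem_always[OF fresh(2)] sem_so_far[OF fresh(1)]
      sem_inc_matched sem_dec_matched sem_dec_in cond_def
    by (auto simp: positions_def Suc_le_eq)
  let ?G = "{p \<in> positions w. \<forall>q \<in> positions w. p \<le> q \<longrightarrow> good_at w r q}"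
  have "sem w v (matching r) \<subseteq> ?G"
    unfolding matching_def
  proof (rule sem_Mu_least, rule subsetI)
    fix p assume "p \<in> sem w (v(0 := ?G)) ?body"
    then have p: "p \<in> positions w" "p = length w \<or> Suc p \<in> ?G" and cond: "cond ?G p"
      unfolding body by auto
    have "good_at w r p"
    proof (rule ccontr)
      assume bad: "\<not> good_at w r p"
      \<comment> \<open>A bad \<open>p\<close> keeps every position up to \<open>p\<close> out of
        \<open>?G\<close>. Membership in \<open>?G\<close> then implies the order condition, which
        makes \<open>p\<close> good after all.\<close>
      then have "\<forall>i \<in> ?G. p < i" using p(1) by (auto simp: not_le[symmetric])
      with cond have "good_at w r p" unfolding cond_def good_at_def by blast
      with bad show False ..
    qed
    moreover have "good_at w r q" if "q \<in> positions w" "p < q" for q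
      using that p(2) by (auto simp: positions_def)
    ultimately show "p \<in> ?G" using p(1) by (auto simp: le_less)
  qed
  moreover have "p \<in> sem w v (matching r)" if good: "good w r" and "p \<in> positions w" for p
    using that(2) unfolding matching_def
  proof (induction "length w - p" arbitrary: p rule: less_induct)
    case less
    let ?S = "sem w v (Mu 0 ?body)"
    \<comment> \<open>By induction all later positions are in the fixpoint, in particular the class
      predecessors that lie after a test at \<open>p\<close>.\<close>
    have later: "q \<in> ?S" if "q \<in> positions w" "p < q" for q
      using that less.prems by (intro less.hyps) (auto simp: positions_def)
    have "good_at w r p" using good less.prems by (simp add: good_def)
    then have "cond ?S p"
      unfolding cond_def good_at_def using later by (meson is_class_pred_def)
    then have "p \<in> sem w (v(0 := ?S)) ?body"
      unfolding body using less.prems later[of "Suc p"] by (auto simp: positions_def)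
    then show ?case by (subst sem_Mu_unfold)
  qed
  ultimately show ?thesis
    by (cases w) (auto simp: good_def positions_def)
qed


text \<open>The matching conditions are evaluated at position 1, whereas the program formula is
  evaluated after the increments put in front. Walking back lets the formula stay the same for every
  input.\<close>

definition at_first :: "'a fml \<Rightarrow> 'a fml" where
  "at_first \<phi> = Mu 0 (Or (And (Atom FirstG) \<phi>) (Modal YG (Var 0)))"

lemma sem_at_first:
  assumes "free_vars \<phi> = {}"
  shows "i \<in> sem w v (at_first \<phi>) \<longleftrightarrow> i \<in> positions w \<and> 1 \<in> sem w v \<phi>"
proof -
  have body: "i \<in> sem w (v(0 := S)) (Or (And (Atom FirstG) \<phi>) (Modal YG (Var 0))) \<longleftrightarrow>
      i \<in> positions w \<and> (i = 1 \<and> 1 \<in> sem w v \<phi> \<or> i - 1 \<in> positions w \<and> i - 1 \<in> S)" for S i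
    using sem_upd_fresh[of 0 \<phi> w v S] assms by (auto simp: positions_def)
  have "sem w v (at_first \<phi>) \<subseteq> {i \<in> positions w. 1 \<in> sem w v \<phi>}"
    unfolding at_first_def by (rule sem_Mu_least, rule subsetI, unfold body) auto
  moreover have "i \<in> sem w v (at_first \<phi>)" if "1 \<in> sem w v \<phi>" "i \<in> positions w"
    using that(2) unfolding at_first_def
  proof (induction i)
    case 0
    then show ?case by (simp add: positions_def)
  next
    case (Suc i)
    have "i \<in> sem w v (Mu 0 (Or (And (Atom FirstG) \<phi>) (Modal YG (Var 0))))" if "Suc i \<noteq> 1"
      using Suc.prems that by (intro Suc.IH) (auto simp: positions_def)
    then show ?case using Suc.prems \<open>1 \<in> sem w v \<phi>\<close>
      by (subst sem_Mu_unfold, unfold body) (auto simp: positions_def)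
  qed
  ultimately show ?thesis by blast
qed

text \<open>\<open>FirstG\<close> serves as the neutral conjunct, being true at position 1.\<close>

definition matchings :: "nat list \<Rightarrow> nat fml" where
  "matchings rs = foldr (\<lambda>r. And (matching r)) rs (Atom FirstG)"

lemma free_vars_matching: "free_vars (matching r) = {}"
  by (auto simp: matching_def dec_matched_def so_far_def inc_matched_def always_def dec_in_def)

lemma mu_fragment_matching: "mu_fragment (matching r)"
  by (simp add: matching_def dec_matched_def so_far_def inc_matched_def always_def dec_in_def)

lemma free_vars_matchings: "free_vars (matchings rs) = {}"
  by (induction rs) (simp_all add: matchings_def free_vars_matching)

lemma mu_fragment_matchings: "mu_fragment (matchings rs)"
  by (induction rs) (simp_all add: matchings_def mu_fragment_matching)

lemma sem_matchings: "1 \<in> sem w v (matchings rs) \<longleftrightarrow> w \<noteq> [] \<and> (\<forall>r \<in> set rs. good w r)"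
proof (induction rs)
  case Nil
  then show ?case by (cases w) (simp_all add: matchings_def positions_def)
next
  case (Cons r rs)
  have "1 \<in> sem w v (matchings (r # rs)) \<longleftrightarrow>
      1 \<in> sem w v (matching r) \<and> 1 \<in> sem w v (matchings rs)"
    by (simp add: matchings_def)
  then show ?case unfolding Cons sem_matching by auto
qed

text \<open>The final letter only provides the position that the last \<open>XG\<close> leads to.\<close>

definition prog_fml :: "prog \<Rightarrow> nat fml" where
  "prog_fml p = And (tr 0 p (Atom (Letter (act_code (Inc 0)))))
    (at_first (matchings (map reg (Inc 0 # acts p))))"

text \<open>Each unit of the input wraps one fixed context around the formula, so on codes this is a
  primitive recursion in \<open>n\<close>.\<close>

fun prefix :: "nat \<Rightarrow> nat fml \<Rightarrow> nat fml" where
  "prefix 0 \<phi> = \<phi>"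
| "prefix (Suc n) \<phi> = And (Atom (Letter (act_code (Inc 0)))) (Modal XG (prefix n \<phi>))"

lemma free_vars_prog_fml: "free_vars (prog_fml p) = {}"
  using free_vars_tr[of 0 p "Atom (Letter (act_code (Inc 0)))"]
  by (simp add: prog_fml_def at_first_def free_vars_matchings)

lemma mu_fragment_prog_fml: "mu_fragment (prog_fml p)"
  by (simp add: prog_fml_def at_first_def mu_fragment_tr mu_fragment_matchings)

lemma act_code_in_prog_fml: "act_code ` set (Inc 0 # acts p) \<subseteq> set_fml (prog_fml p)"
  using act_code_in_tr[of p 0] set_fml_tr_cont[of "Atom (Letter (act_code (Inc 0)))" 0 p]
  by (auto simp: prog_fml_def)

lemma free_vars_prefix: "free_vars (prefix n \<phi>) = free_vars \<phi>"
  by (induction n) auto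

lemma mu_fragment_prefix: "mu_fragment (prefix n \<phi>) \<longleftrightarrow> mu_fragment \<phi>"
  by (induction n) auto

lemma set_fml_prefix: "set_fml (prefix n \<phi>) \<subseteq> insert (act_code (Inc 0)) (set_fml \<phi>)"
  by (induction n) auto

lemma sem_prefix:
  "i \<in> sem w v (prefix n \<phi>) \<longleftrightarrow>
    i \<in> positions w \<and> spells w i (replicate n (Inc 0)) \<and> i + n \<in> sem w v \<phi>"
proof (induction n arbitrary: i)
  case 0
  then show ?case using sem_imp_position[of i w v \<phi>] by auto
next
  case (Suc n)
  have "i \<in> positions w \<Longrightarrow> i + Suc n \<in> sem w v \<phi> \<Longrightarrow> Suc i \<in> positions w"
    using sem_imp_position[of "i + Suc n" w v \<phi>] by (simp add: positions_def)
  then show ?case using Suc[of "Suc i"] by auto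
qed

lemma models_prefix:
  "w \<Turnstile> prefix n (prog_fml p) \<longleftrightarrow>
    (\<exists>as \<in> lang p. length (replicate n (Inc 0) @ as @ [Inc 0]) \<le> length w \<and>
      spells w 1 (replicate n (Inc 0) @ as @ [Inc 0]) \<and>
      (\<forall>r \<in> reg ` set (Inc 0 # acts p). good w r))" (is "?L \<longleftrightarrow> ?R")
proof -
  let ?as = "\<lambda>as. replicate n (Inc 0) @ as @ [Inc 0]"
  have *: "i \<in> sem w v (prog_fml p) \<longleftrightarrow> i \<in> positions w \<and>
      (\<exists>as \<in> lang p. spells w i as \<and> i + length as \<in> positions w \<and>
        letter_at w (i + length as) = act_code (Inc 0)) \<and>
      w \<noteq> [] \<and> (\<forall>r \<in> reg ` set (Inc 0 # acts p). good w r)" for i v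
    using sem_matchings[of w v "map reg (Inc 0 # acts p)"]
    by (auto simp: prog_fml_def sem_tr sem_at_first[OF free_vars_matchings])
  have "?L \<longleftrightarrow> 1 \<in> positions w \<and> spells w 1 (replicate n (Inc 0)) \<and>
      1 + n \<in> positions w \<and>
      (\<exists>as \<in> lang p. spells w (1 + n) as \<and> 1 + n + length as \<in> positions w \<and>
        letter_at w (1 + n + length as) = act_code (Inc 0)) \<and>
      w \<noteq> [] \<and> (\<forall>r \<in> reg ` set (Inc 0 # acts p). good w r)"
    unfolding models_def sem_prefix * ..
  also have "\<dots> \<longleftrightarrow> ?R"
    by (auto simp: spells_append positions_def)
  finally show ?thesis .
qed

section \<open>Reduction of halting to satisfiability\<close>

lemma run_replicate_Inc: "run (replicate n (Inc r)) s s' \<longleftrightarrow> s' = s(r := s r + n)"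
  by (induction n arbitrary: s) auto

text \<open>A model spells the increments that load \<open>n\<close> into counter 0, then a sequence
  of the program; its matchings make the whole executable. Conversely, a run is balanced and
  \<open>word_of\<close> turns it into a model.\<close>

lemma satisfiable_prefix:
  fixes D :: "'d set"
  assumes D: "infinite D" and L: "act_code ` set (Inc 0 # acts p) \<subseteq> L"
  shows "satisfiable L D (prefix n (prog_fml p)) \<longleftrightarrow> (\<exists>s'. exec p ((\<lambda>_. 0)(0 := n)) s')"
proof
  assume "satisfiable L D (prefix n (prog_fml p))"
  then obtain w :: "(nat, 'd) data_word" and as where as: "as \<in> lang p"
    "length (replicate n (Inc 0) @ as @ [Inc 0]) \<le> length w"
    "spells w 1 (replicate n (Inc 0) @ as @ [Inc 0])"
    "\<forall>r \<in> reg ` set (Inc 0 # acts p). good w r"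
    unfolding satisfiable_def models_prefix by blast
  \<comment> \<open>All registers of the spelled sequence are among those whose matching the formula
    demands.\<close>
  have "set (replicate n (Inc 0) @ as @ [Inc 0]) \<subseteq> set (Inc 0 # acts p)"
    using lang_acts[OF as(1)] by auto
  then have "balanced (replicate n (Inc 0) @ as @ [Inc 0])"
    using as by (intro good_imp_balanced[of _ w]) blast+
  then obtain s' where "run (replicate n (Inc 0) @ as @ [Inc 0]) (\<lambda>_. 0) s'"
    using runs_iff_balanced by blast
  then show "\<exists>s'. exec p ((\<lambda>_. 0)(0 := n)) s'"
    using as(1) by (auto simp: run_append run_replicate_Inc exec_def)
next
  assume "\<exists>s'. exec p ((\<lambda>_. 0)(0 := n)) s'"
  then obtain as s' where as: "as \<in> lang p" "run as ((\<lambda>_. 0)(0 := n)) s'"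
    by (auto simp: exec_def)
  let ?as = "replicate n (Inc 0) @ as @ [Inc 0]"
  have "\<exists>s''. run ?as (\<lambda>_. 0) s''"
    using as(2) by (auto simp: run_append run_replicate_Inc)
  then have bal: "balanced ?as" using runs_iff_balanced by blast
  \<comment> \<open>Infinitely many data values leave room for a separate one per key.\<close>
  obtain \<delta> :: "nat \<Rightarrow> 'd" where \<delta>: "inj \<delta>" "range \<delta> \<subseteq> D"
    using infinite_countable_subset[OF D] by blast
  let ?w = "word_of \<delta> ?as"
  have "act_code ` set ?as \<subseteq> L" using lang_acts[OF as(1)] L by auto
  then have "?w \<in> lists (L \<times> D)" 
    by (intro subsetD[OF lists_mono[OF Sigma_mono[OF _ subset_refl]] word_of_in_lists[OF \<delta>(2)]])
  moreover have "?w \<Turnstile> prefix n (prog_fml p)"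
    unfolding models_prefix using as(1) spells_word_of[of \<delta> ?as] good_word_of[OF \<delta>(1) bal]
    by (intro bexI[of _ as]) simp_all
  ultimately show "satisfiable L D (prefix n (prog_fml p))"
    unfolding satisfiable_def by blast
qed


section \<open>The diagonal argument\<close>

primrec const_rec :: "nat \<Rightarrow> recf" where
  "const_rec 0 = Zero"
| "const_rec (Suc n) = Comp Succ [const_rec n]"

definition add_rec :: recf where
  "add_rec = PrimRec (Proj 0) (Comp Succ [Proj 1])"

definition triangle_rec :: recf where
  "triangle_rec = PrimRec Zero (Comp Succ [Comp add_rec [Proj 0, Proj 1]])"

text \<open>\<open>prod_encode\<close> is Cantor pairing: the triangular number of the sum plus the
  first component.\<close>

definition pair_rec :: recf where
  "pair_rec = Comp add_rec [Comp triangle_rec [add_rec], Proj 0]"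

text \<open>The constants 5, 3 and 0 are the codes of \<open>And\<close>, \<open>Modal\<close> and
  \<open>XG\<close>; \<open>Proj 1\<close> is the code from the previous round.\<close>

definition prefix_rec :: recf where
  "prefix_rec = PrimRec (Proj 0)
    (Comp pair_rec [const_rec 5, Comp pair_rec [const_rec (fml_code (Atom (Letter (act_code (Inc 0))))),
      Comp pair_rec [const_rec 3, Comp pair_rec [const_rec 0, Proj 1]]]])"

text \<open>The diagonal: one code acts as alphabet size, as number of increments and as the formula
  to be prefixed.\<close>

definition instance_rec :: recf where
  "instance_rec = Comp pair_rec [Proj 0, Comp prefix_rec [Proj 0, Proj 0]]"

lemma computes_const_rec: "computes (const_rec n) xs y \<longleftrightarrow> y = n"
  by (induction n arbitrary: y) (auto simp: computes_Comp_iff list_all2_Cons1 computes_Succ_iff)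

lemma computes_add_rec: "computes add_rec [m, n] y \<longleftrightarrow> y = m + n"
  unfolding add_rec_def
  by (induction m arbitrary: y)
    (simp_all add: computes_PrimRec_0_iff computes_PrimRec_Suc_iff computes_Comp_iff
      computes_Proj_iff computes_Succ_iff list_all2_Cons1)

lemma computes_triangle_rec: "computes triangle_rec [n] y \<longleftrightarrow> y = triangle n"
  unfolding triangle_rec_def
  by (induction n arbitrary: y)
    (simp_all add: computes_PrimRec_0_iff computes_PrimRec_Suc_iff computes_Comp_iff
      computes_Proj_iff computes_Succ_iff computes_add_rec list_all2_Cons1 add.commute)

lemma computes_pair_rec: "computes pair_rec [m, n] y \<longleftrightarrow> y = prod_encode (m, n)"
  unfolding pair_rec_def
  by (simp add: computes_Comp_iff computes_Proj_iff computes_add_rec computes_triangle_rec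
      list_all2_Cons1 prod_encode_def)

lemma computes_prefix_rec:
  "computes prefix_rec [n, fml_code \<phi>] y \<longleftrightarrow> y = fml_code (prefix n \<phi>)"
  unfolding prefix_rec_def
  by (induction n arbitrary: y)
    (simp_all add: computes_PrimRec_0_iff computes_PrimRec_Suc_iff computes_Comp_iff
      computes_Proj_iff computes_const_rec computes_pair_rec list_all2_Cons1 del: const_rec.simps)

lemma computes_instance_rec:
  "computes instance_rec [fml_code \<phi>] y \<longleftrightarrow>
    y = instance_code (fml_code \<phi>, prefix (fml_code \<phi>) \<phi>)"
  unfolding instance_rec_def
  by (simp add: computes_Comp_iff computes_Proj_iff computes_prefix_rec computes_pair_rec
      list_all2_Cons1 instance_code_def)

lemma atom_letter_le: "a \<in> set_atom A \<Longrightarrow> a < atom_code A"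
  by (cases A) auto

text \<open>A pair code is never below its components, and the code of a letter atom exceeds the
  letter. The code of a formula is thus a sufficient alphabet size.\<close>

lemma fml_letter_less: "a \<in> set_fml \<phi> \<Longrightarrow> a < fml_code \<phi>"
proof (induction \<phi>)
  case (Atom A)
  then show ?case using atom_letter_le[of a A] le_prod_encode_2[of "atom_code A" 1] by simp
next
  case (NegAtom A)
  then show ?case using atom_letter_le[of a A] le_prod_encode_2[of "atom_code A" 2] by simp
qed (simp_all, (meson le_prod_encode_1 le_prod_encode_2 less_le_trans)+)

theorem theorem3:
  fixes D :: "'d set"
  assumes "infinite D"
  shows "\<not> decidable_problem instance_code mu_instances (\<lambda>(k, \<phi>). satisfiable {..<k} D \<phi>)"
proof
  assume "decidable_problem instance_code mu_instances (\<lambda>(k, \<phi>). satisfiable {..<k} D \<phi>)"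
  then obtain d where d: "\<And>k \<phi>. (k, \<phi>) \<in> mu_instances \<Longrightarrow>
      computes d [instance_code (k, \<phi>)] (if satisfiable {..<k} D \<phi> then 1 else 0)"
    unfolding decidable_problem_def by fastforce
  define f where "f = Comp d [instance_rec]"
  \<comment> \<open>Input in register 0, output in 1, scratch from 2 on. The test lets a run end
    exactly when the answer is 0.\<close>
  define p where "p = Seq (compile f [0] 1 2) (Act (Test 1))"
  define e where "e = fml_code (prog_fml p)"
  define \<psi> where "\<psi> = prefix e (prog_fml p)"
  have letters: "set_fml (prog_fml p) \<subseteq> {..<e}"
    unfolding e_def using fml_letter_less by auto
  moreover from this have acts: "act_code ` set (Inc 0 # acts p) \<subseteq> {..<e}"
    using act_code_in_prog_fml by (rule order_trans[rotated])
  ultimately have "set_fml \<psi> \<subseteq> {..<e}"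
    unfolding \<psi>_def using set_fml_prefix[of e "prog_fml p"] by auto
  then have inst: "(e, \<psi>) \<in> mu_instances"
    by (simp add: mu_instances_def sentence_def \<psi>_def free_vars_prefix free_vars_prog_fml
        mu_fragment_prefix mu_fragment_prog_fml)
  have f: "exec (compile f [0] 1 2) ((\<lambda>_. 0)(0 := e)) s1 \<longleftrightarrow>
      (\<exists>y. computes f [e] y \<and> s1 = (\<lambda>_. 0)(0 := e, 1 := y))" for s1
    using correctD[OF correct, of "[0]" 2 1 "(\<lambda>_. 0)(0 := e)" f s1] by simp
  have "satisfiable {..<e} D \<psi> \<longleftrightarrow> (\<exists>s'. exec p ((\<lambda>_. 0)(0 := e)) s')"
    unfolding \<psi>_def by (rule satisfiable_prefix[OF assms acts])
  also have "\<dots> \<longleftrightarrow> computes f [e] 0"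
    unfolding p_def exec_Seq f by auto
  also have "\<dots> \<longleftrightarrow> computes d [instance_code (e, \<psi>)] 0"
    unfolding f_def e_def \<psi>_def by (simp add: computes_Comp_iff list_all2_Cons1 computes_instance_rec)
  finally have "satisfiable {..<e} D \<psi> \<longleftrightarrow> computes d [instance_code (e, \<psi>)] 0" .
  \<comment> \<open>If \<open>\<psi>\<close> is satisfiable, \<open>d\<close> yields both 0 and 1;
    if not, \<open>d\<close> yields 0, which would make \<open>\<psi>\<close> satisfiable.\<close>
  with d[OF inst] computes_deterministic show False by (fastforce split: if_splits)
qed

end
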